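(* Let $K$ be a field. The groups $\mathrm{Aut}_1\,\mathbb{A}^2_K$ and $\mathrm{Aut}_{U(K)}\,\mathbb{A}^2_K$ embed in $\mathrm{SL}(2,K(t))$. Moreover, if $K\supset k(t)$ for some infinite field $k$ (i.e. $K$ contains a subfield which is the field of rational functions in one variable over an infinite field $k$), then there exists an embedding of $\mathrm{Aut}_{U(K)}\,\mathbb{A}^2_K$, and hence of its subgroup $\mathrm{Aut}_1\,\mathbb{A}^2_K$, in $\mathrm{SL}(2,K)$.
   Context: $\mathrm{Aut}\,\mathbb{A}^2_K$ is the group of polynomial automorphisms of the affine plane over $K$ (pairs of polynomials in $K[x,y]$ invertible under composition), and $\mathrm{Aut}_0\,\mathbb{A}^2_K$ is the subgroup of those $\phi$ with $\phi(\mathbf 0)=\mathbf 0$. For a subgroup $S\subset\mathrm{GL}(2,K)$, $\mathrm{Aut}_S\,\mathbb{A}^2_K=\{\phi\in\mathrm{Aut}_0\,\mathbb{A}^2_K\mid \mathrm{d}\phi|_{\mathbf 0}\in S\}$; $\mathrm{Aut}_1\,\mathbb{A}^2_K$ denotes the case $S=\{1\}$. $U(K)$ is the group of linear maps $(x,y)\mapsto(x,y+ax)$ with $a\in K$. Embeddings are injective homomorphisms of abstract groups. $K(t)$ is the field of rational functions in one variable over $K$. *)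

theory Defs
  imports "HOL-Analysis.Analysis" "HOL-Algebra.Group" "HOL-Computational_Algebra.Fraction_Field"
begin

text \<open>
  The polynomial ring \<open>K[x,y]\<close> is represented by the type \<open>'a poly poly\<close>, read as \<open>(K[x])[y]\<close>:
  the inner variable is \<open>x\<close>, the outer one is \<open>y\<close>.  A polynomial self-map of the affine plane is a
  pair of such polynomials.  These are formal polynomials, so that nothing is lost over finite fields.
\<close>

type_synonym 'a poly2 = "'a poly poly"

definition poly2_x :: "'a::field poly2" where
  "poly2_x = [:[:0, 1:]:]"

definition poly2_y :: "'a::field poly2" where
  "poly2_y = [:0, 1:]"

definition poly2_eval :: "'a::field poly2 \<Rightarrow> 'a \<Rightarrow> 'a \<Rightarrow> 'a" where
  "poly2_eval p a b = poly (poly p [:b:]) a"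

definition poly2_subst :: "'a::field poly2 \<Rightarrow> 'a poly2 \<times> 'a poly2 \<Rightarrow> 'a poly2" where
  "poly2_subst p \<psi> =
     poly (map_poly (\<lambda>c. poly (map_poly (\<lambda>a. [:[:a:]:]) c) (fst \<psi>)) p) (snd \<psi>)"

definition poly2_comp ::
    "'a::field poly2 \<times> 'a poly2 \<Rightarrow> 'a poly2 \<times> 'a poly2 \<Rightarrow> 'a poly2 \<times> 'a poly2" where
  "poly2_comp \<phi> \<psi> = (poly2_subst (fst \<phi>) \<psi>, poly2_subst (snd \<phi>) \<psi>)"

definition End_A2 :: "('a::field poly2 \<times> 'a poly2) monoid" where
  "End_A2 = \<lparr>carrier = UNIV, mult = poly2_comp, one = (poly2_x, poly2_y)\<rparr>"

definition Aut_A2 :: "('a::field poly2 \<times> 'a poly2) monoid" where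
  "Aut_A2 = units_of End_A2"

text \<open>The partial derivatives are \<open>map_poly pderiv\<close> with respect to \<open>x\<close> and \<open>pderiv\<close> with respect to \<open>y\<close>.\<close>

definition diff_at_0 :: "'a::field poly2 \<times> 'a poly2 \<Rightarrow> 'a^2^2" where
  "diff_at_0 \<phi> = vector
     [vector [poly2_eval (map_poly pderiv (fst \<phi>)) 0 0, poly2_eval (pderiv (fst \<phi>)) 0 0],
      vector [poly2_eval (map_poly pderiv (snd \<phi>)) 0 0, poly2_eval (pderiv (snd \<phi>)) 0 0]]"

definition Aut0_A2 :: "('a::field poly2 \<times> 'a poly2) monoid" where
  "Aut0_A2 = Aut_A2\<lparr>carrier :=
     {\<phi> \<in> carrier Aut_A2. poly2_eval (fst \<phi>) 0 0 = 0 \<and> poly2_eval (snd \<phi>) 0 0 = 0}\<rparr>"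

definition AutS_A2 :: "('a::field^2^2) set \<Rightarrow> ('a poly2 \<times> 'a poly2) monoid" where
  "AutS_A2 S = Aut0_A2\<lparr>carrier := {\<phi> \<in> carrier Aut0_A2. diff_at_0 \<phi> \<in> S}\<rparr>"

definition U_lin :: "('a::field^2^2) set" where
  "U_lin = {M. \<exists>a. \<forall>v. M *v v = vector [v $ 1, v $ 2 + a * v $ 1]}"

definition SL2 :: "'b::field itself \<Rightarrow> ('b^2^2) monoid" where
  "SL2 _ = \<lparr>carrier = {M. det M = 1}, mult = (**), one = mat 1\<rparr>"

definition group_embeds :: "('g, 'm) monoid_scheme \<Rightarrow> ('h, 'n) monoid_scheme \<Rightarrow> bool" where
  "group_embeds G H \<longleftrightarrow> (\<exists>f. f \<in> mon G H)"

definition field_embedding :: "('k::field \<Rightarrow> 'l::field) \<Rightarrow> bool" where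
  "field_embedding h \<longleftrightarrow> inj h \<and> h 1 = 1 \<and>
     (\<forall>x y. h (x + y) = h x + h y) \<and> (\<forall>x y. h (x * y) = h x * h y)"

lemma eval_map_add:
  fixes h :: "'a::comm_ring_1 \<Rightarrow> 'b::comm_ring_1"
  assumes "h 0 = 0" "\<And>x y. h (x + y) = h x + h y"
  shows "poly (map_poly h (p + q)) z = poly (map_poly h p) z + poly (map_poly h q) z"
proof -
  have "map_poly h (p + q) = map_poly h p + map_poly h q"
    by (rule poly_eqI) (simp add: coeff_map_poly assms)
  then show ?thesis by simp
qed

lemma eval_map_mult:
  fixes h :: "'a::comm_ring_1 \<Rightarrow> 'b::comm_ring_1"
  assumes 0: "h 0 = 0" and a: "\<And>x y. h (x + y) = h x + h y" and m: "\<And>x y. h (x * y) = h x * h y"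
  shows "poly (map_poly h (p * q)) z = poly (map_poly h p) z * poly (map_poly h q) z"
proof (induction p)
  case 0
  show ?case by simp
next
  case (pCons c p)
  have s: "map_poly h (smult c q) = smult (h c) (map_poly h q)"
    by (rule poly_eqI) (simp add: coeff_map_poly 0 m)
  have "poly (map_poly h (pCons c p * q)) z
      = poly (map_poly h (smult c q)) z + poly (map_poly h (pCons 0 (p * q))) z"
    by (simp only: mult_pCons_left eval_map_add[OF 0 a])
  also have "\<dots> = poly (map_poly h (pCons c p)) z * poly (map_poly h q) z"
    by (simp add: s map_poly_pCons pCons.IH 0 algebra_simps)
  finally show ?case .
qed

lemma poly2_subst_const: "poly2_subst [:[:a:]:] \<psi> = [:[:a:]:]"
  by (simp add: poly2_subst_def map_poly_pCons)

lemma poly2_subst_0_1 [simp]: "poly2_subst 0 \<psi> = 0" "poly2_subst 1 \<psi> = 1"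
  by (simp_all add: poly2_subst_def map_poly_1 flip: one_pCons)

lemma poly2_subst_x [simp]: "poly2_subst poly2_x \<psi> = fst \<psi>"
  by (simp add: poly2_subst_def poly2_x_def map_poly_pCons flip: one_pCons)

lemma poly2_subst_y [simp]: "poly2_subst poly2_y \<psi> = snd \<psi>"
  by (simp add: poly2_subst_def poly2_y_def map_poly_pCons flip: one_pCons)

lemma inner_add:
  "poly (map_poly (\<lambda>a::'a::field. [:[:a:]:]) (c + d)) f
     = poly (map_poly (\<lambda>a. [:[:a:]:]) c) f + poly (map_poly (\<lambda>a. [:[:a:]:]) d) f"
  by (rule eval_map_add) simp_all

lemma inner_mult:
  "poly (map_poly (\<lambda>a::'a::field. [:[:a:]:]) (c * d)) f
     = poly (map_poly (\<lambda>a. [:[:a:]:]) c) f * poly (map_poly (\<lambda>a. [:[:a:]:]) d) f"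
  by (rule eval_map_mult) simp_all

lemma poly2_subst_add: "poly2_subst (p + q) \<psi> = poly2_subst p \<psi> + poly2_subst q \<psi>"
  unfolding poly2_subst_def by (rule eval_map_add) (simp_all add: inner_add)

lemma poly2_subst_mult: "poly2_subst (p * q) \<psi> = poly2_subst p \<psi> * poly2_subst q \<psi>"
  unfolding poly2_subst_def by (rule eval_map_mult) (simp_all add: inner_add inner_mult)

lemma poly2_induct [case_names const x y add mult]:
  assumes c: "\<And>a. P [:[:a:]:]" and x: "P poly2_x" and y: "P poly2_y"
    and add: "\<And>p q. P p \<Longrightarrow> P q \<Longrightarrow> P (p + q)" and mult: "\<And>p q. P p \<Longrightarrow> P q \<Longrightarrow> P (p * q)"
  shows "P (p :: 'a::field poly2)"
proof -
  have in_x: "P [:r:]" for r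
  proof (induction r)
    case 0
    show ?case using c[of 0] by simp
  next
    case (pCons a r)
    have "[:pCons a r:] = [:[:a:]:] + poly2_x * [:r:]" by (simp add: poly2_x_def)
    then show ?case using add mult c x pCons.IH by metis
  qed
  show ?thesis
  proof (induction p)
    case 0
    show ?case using c[of 0] by simp
  next
    case (pCons r p)
    have "pCons r p = [:r:] + poly2_y * p" by (simp add: poly2_y_def)
    then show ?case using add mult in_x y pCons.IH by metis
  qed
qed

lemma poly2_subst_id [simp]: "poly2_subst p (poly2_x, poly2_y) = p"
  by (induction p rule: poly2_induct)
     (simp_all add: poly2_subst_add poly2_subst_mult poly2_subst_const)

lemma poly2_subst_subst: "poly2_subst (poly2_subst p \<phi>) \<psi> = poly2_subst p (poly2_comp \<phi> \<psi>)"
  by (induction p rule: poly2_induct)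
     (simp_all add: poly2_subst_add poly2_subst_mult poly2_subst_const poly2_comp_def)

lemma poly2_eval_add: "poly2_eval (p + q) a b = poly2_eval p a b + poly2_eval q a b"
  by (simp add: poly2_eval_def)

lemma poly2_eval_mult: "poly2_eval (p * q) a b = poly2_eval p a b * poly2_eval q a b"
  by (simp add: poly2_eval_def)

lemma poly2_eval_basic [simp]:
  "poly2_eval [:[:c:]:] a b = c" "poly2_eval poly2_x a b = a" "poly2_eval poly2_y a b = b"
  by (simp_all add: poly2_eval_def poly2_x_def poly2_y_def)

lemma poly2_eval_subst:
  "poly2_eval (poly2_subst p \<psi>) a b = poly2_eval p (poly2_eval (fst \<psi>) a b) (poly2_eval (snd \<psi>) a b)"
  by (induction p rule: poly2_induct)
     (simp_all add: poly2_subst_add poly2_subst_mult poly2_subst_const poly2_eval_add poly2_eval_mult)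

lemma pderiv_x_rules:
  "map_poly pderiv (p + q) = map_poly pderiv p + map_poly pderiv (q :: 'a::field poly2)"
  "map_poly pderiv (p * q) = p * map_poly pderiv q + map_poly pderiv p * q"
proof -
  show add: "map_poly pderiv (p + q) = map_poly pderiv p + map_poly pderiv q" for p q :: "'a poly2"
    by (rule poly_eqI) (simp add: coeff_map_poly pderiv_add)
  have smult: "map_poly pderiv (smult c q) = smult c (map_poly pderiv q) + smult (pderiv c) q"
    for c :: "'a poly" and q
    by (rule poly_eqI) (simp add: coeff_map_poly pderiv_mult mult.commute)
  show "map_poly pderiv (p * q) = p * map_poly pderiv q + map_poly pderiv p * q"
  proof (induction p)
    case 0
    show ?case by simp
  next
    case (pCons c p)
    then show ?case by (simp add: add smult map_poly_pCons)
  qed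
qed

lemma poly2_chain_rule:
  assumes "D \<in> {map_poly pderiv, pderiv}"
  shows "D (poly2_subst p \<psi>)
    = poly2_subst (map_poly pderiv p) \<psi> * D (fst \<psi>) + poly2_subst (pderiv p) \<psi> * D (snd \<psi>)"
proof (induction p rule: poly2_induct)
  case (const a)
  from assms show ?case by (auto simp: poly2_subst_const map_poly_pCons)
next
  case x
  have "map_poly pderiv poly2_x = (1 :: 'a poly2)" "pderiv poly2_x = (0 :: 'a poly2)"
    by (simp_all add: poly2_x_def map_poly_pCons pderiv_pCons flip: one_pCons)
  then show ?case by simp
next
  case y
  have "map_poly pderiv poly2_y = (0 :: 'a poly2)" "pderiv poly2_y = (1 :: 'a poly2)"
    by (simp_all add: poly2_y_def map_poly_pCons map_poly_1 pderiv_pCons flip: one_pCons)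
  then show ?case by simp
next
  case (add p q)
  with assms show ?case
    by (auto simp: poly2_subst_add pderiv_x_rules pderiv_add algebra_simps)
next
  case (mult p q)
  with assms show ?case
    by (auto simp: poly2_subst_add poly2_subst_mult pderiv_x_rules pderiv_mult algebra_simps)
qed

lemma diff_at_0_comp:
  assumes "poly2_eval (fst \<psi>) 0 0 = 0" "poly2_eval (snd \<psi>) 0 0 = 0"
  shows "diff_at_0 (poly2_comp \<phi> \<psi>) = diff_at_0 \<phi> ** diff_at_0 \<psi>"
  by (simp add: diff_at_0_def poly2_comp_def vec_eq_iff forall_2 matrix_matrix_mult_def sum_2
      poly2_chain_rule[where D = pderiv] poly2_chain_rule[where D = "map_poly pderiv"]
      poly2_eval_add poly2_eval_mult poly2_eval_subst assms)

lemma monoid_End_A2: "Group.monoid End_A2"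
  by (rule Group.monoidI)
     (auto simp: End_A2_def poly2_subst_subst, auto simp: poly2_comp_def poly2_subst_subst)

lemma group_Aut_A2: "group Aut_A2"
  unfolding Aut_A2_def by (rule monoid.units_group[OF monoid_End_A2])

lemma matrix_eq_iff_mult: "M = N \<longleftrightarrow> (\<forall>v. M *v v = N *v v)" for M N :: "'a::field^2^2"
  by (metis matrix_eq)

lemma U_lin_eq: "(U_lin :: ('a::field^2^2) set) = {vector [vector [1, 0], vector [a, 1]] | a. True}"
proof -
  have *: "(vector [vector [1, 0], vector [a, 1]] :: 'a^2^2) *v v = vector [v $ 1, v $ 2 + a * v $ 1]"
    for a :: 'a and v :: "'a^2"
    by (simp add: vec_eq_iff forall_2 matrix_vector_mult_def sum_2 add.commute)
  show ?thesis
    unfolding U_lin_def by (auto simp: matrix_eq_iff_mult *)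
qed

lemma diff_at_0_id: "diff_at_0 (poly2_x, poly2_y) = mat 1"
  by (simp add: diff_at_0_def vec_eq_iff forall_2 mat_def poly2_eval_def poly2_x_def poly2_y_def
      map_poly_pCons map_poly_1 pderiv_pCons flip: one_pCons)

lemma group_AutS_A2:
  fixes S :: "('a::field^2^2) set"
  assumes one: "mat 1 \<in> S" and mult: "\<And>A B. A \<in> S \<Longrightarrow> B \<in> S \<Longrightarrow> A ** B \<in> S"
    and inverse: "\<And>A. A \<in> S \<Longrightarrow> \<exists>B\<in>S. A ** B = mat 1"
  shows "group (AutS_A2 S)"
proof -
  have car: "carrier (AutS_A2 S) = {\<phi> \<in> Units End_A2.
      poly2_eval (fst \<phi>) 0 0 = 0 \<and> poly2_eval (snd \<phi>) 0 0 = 0 \<and> diff_at_0 \<phi> \<in> S}"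
    by (auto simp: AutS_A2_def Aut0_A2_def Aut_A2_def units_of_def)
  have ops: "mult (AutS_A2 S) = mult End_A2" "one (AutS_A2 S) = one End_A2"
    by (simp_all add: AutS_A2_def Aut0_A2_def Aut_A2_def units_of_def)
  have End: "mult End_A2 = poly2_comp" "one End_A2 = (poly2_x, poly2_y)" "carrier End_A2 = UNIV"
    by (simp_all add: End_A2_def)
  have comp: "poly2_eval (fst (poly2_comp \<phi> \<psi>)) a b
        = poly2_eval (fst \<phi>) (poly2_eval (fst \<psi>) a b) (poly2_eval (snd \<psi>) a b)"
      "poly2_eval (snd (poly2_comp \<phi> \<psi>)) a b
        = poly2_eval (snd \<phi>) (poly2_eval (fst \<psi>) a b) (poly2_eval (snd \<psi>) a b)"
    for \<phi> \<psi> :: "'a poly2 \<times> 'a poly2" and a b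
    by (simp_all add: poly2_comp_def poly2_eval_subst)
  interpret End: Group.monoid "End_A2 :: ('a poly2 \<times> 'a poly2) monoid" by (rule monoid_End_A2)
  show ?thesis
  proof (rule groupI, unfold ops)
    fix \<phi> \<psi> assume "\<phi> \<in> carrier (AutS_A2 S)" "\<psi> \<in> carrier (AutS_A2 S)"
    then show "\<phi> \<otimes>\<^bsub>End_A2\<^esub> \<psi> \<in> carrier (AutS_A2 S)"
      unfolding car using End.Units_m_closed[of \<phi> \<psi>]
      by (auto simp: End comp diff_at_0_comp mult)
  next
    show "\<one>\<^bsub>End_A2\<^esub> \<in> carrier (AutS_A2 S)"
      unfolding car using End.Units_one_closed by (auto simp: End diff_at_0_id one)
  next
    fix \<phi> assume phi: "\<phi> \<in> carrier (AutS_A2 S)"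
    then have u: "\<phi> \<in> Units End_A2" and e: "poly2_eval (fst \<phi>) 0 0 = 0" "poly2_eval (snd \<phi>) 0 0 = 0"
      and d: "diff_at_0 \<phi> \<in> S" by (auto simp: car)
    define \<psi> where "\<psi> = inv\<^bsub>End_A2\<^esub> \<phi>"
    have psi: "\<psi> \<in> Units End_A2" "poly2_comp \<psi> \<phi> = (poly2_x, poly2_y)"
      using End.Units_inv_Units[OF u] End.Units_l_inv[OF u] by (simp_all add: \<psi>_def End)
    have e': "poly2_eval (fst \<psi>) 0 0 = 0" "poly2_eval (snd \<psi>) 0 0 = 0"
      using comp[of \<psi> \<phi> 0 0] by (simp_all add: psi e)
    obtain B where B: "B \<in> S" "diff_at_0 \<phi> ** B = mat 1" using inverse[OF d] by blast
    have "diff_at_0 \<psi> ** diff_at_0 \<phi> = mat 1"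
      using diff_at_0_comp[OF e, of \<psi>] by (simp add: psi diff_at_0_id)
    then have "diff_at_0 \<psi> = B"
      using B by (metis matrix_mul_assoc matrix_mul_lid matrix_mul_rid)
    then have "\<psi> \<in> carrier (AutS_A2 S)" using psi e' B by (auto simp: car)
    then show "\<exists>\<psi>\<in>carrier (AutS_A2 S). \<psi> \<otimes>\<^bsub>End_A2\<^esub> \<phi> = \<one>\<^bsub>End_A2\<^esub>"
      using psi by (auto simp: End)
  qed (use End.m_assoc End.l_one in \<open>simp_all add: End del: End.m_assoc\<close>)
qed

lemma group_Aut1_A2: "group (AutS_A2 {mat 1 :: 'a::field^2^2})"
  by (rule group_AutS_A2) auto

lemma group_AutU_A2: "group (AutS_A2 (U_lin :: ('a::field^2^2) set))"
proof (rule group_AutS_A2)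
  show "mat 1 \<in> (U_lin :: ('a^2^2) set)"
    unfolding U_lin_def by (auto simp: vec_eq_iff forall_2 intro!: exI[of _ 0])
next
  fix A B :: "'a^2^2" assume "A \<in> U_lin" "B \<in> U_lin"
  then obtain a b where ab: "\<And>v. A *v v = vector [v $ 1, v $ 2 + a * v $ 1]"
      "\<And>v. B *v v = vector [v $ 1, v $ 2 + b * v $ 1]"
    unfolding U_lin_def by blast
  have "(A ** B) *v v = vector [v $ 1, v $ 2 + (a + b) * v $ 1]" for v
    by (simp add: ab algebra_simps flip: matrix_vector_mul_assoc)
  then show "A ** B \<in> U_lin" unfolding U_lin_def by blast
next
  fix A :: "'a^2^2" assume "A \<in> U_lin"
  then obtain a where A: "A = vector [vector [1, 0], vector [a, 1]]" by (auto simp: U_lin_eq)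
  let ?B = "vector [vector [1, 0], vector [- a, 1]] :: 'a^2^2"
  have "A ** ?B = mat 1"
    by (simp add: A vec_eq_iff forall_2 matrix_matrix_mult_def sum_2 mat_def)
  moreover have "?B \<in> U_lin" by (auto simp: U_lin_eq)
  ultimately show "\<exists>B\<in>U_lin. A ** B = mat 1" by blast
qed

lemma group_SL2: "group (SL2 TYPE('b::field))"
proof (rule groupI)
  fix M :: "'b^2^2"
  assume "M \<in> carrier (SL2 TYPE('b))"
  then have d: "det M = 1" by (simp add: SL2_def)
  then have "invertible M" by (simp add: invertible_det_nz)
  then obtain N where N: "N ** M = mat 1" by (auto simp: invertible_def)
  have "det N * det M = 1" by (metis N det_mul det_I)
  with d N show "\<exists>N\<in>carrier (SL2 TYPE('b)). N \<otimes>\<^bsub>SL2 TYPE('b)\<^esub> M = \<one>\<^bsub>SL2 TYPE('b)\<^esub>"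
    by (auto simp: SL2_def)
qed (auto simp: SL2_def det_mul matrix_mul_assoc)

end

theory Submission
  imports Defs "HOL-Algebra.Free_Abelian_Groups"
begin

text \<open>
  Idea.  Let \<open>E\<^sup>+\<close> and \<open>E\<^sup>-\<close> be the groups of maps \<open>(x, y + x f(x))\<close> and \<open>(x + y\<^sup>2 g(y), y)\<close>.
  Degrees show that they generate their free product, and likewise that the elementary matrices with entry
  \<open>\<beta>(f)\<close> below and \<open>\<beta>(g)\<close> above the diagonal generate a free product, whenever \<open>\<beta>\<close> is an injective
  additive map into the polynomials of positive degree (and \<open>0\<close>).  So all that is needed is that \<open>E\<^sup>+\<close>
  and \<open>E\<^sup>-\<close> generate the group belonging to \<open>U(K)\<close>, and that such a \<open>\<beta>\<close> exists.

  Generation is a form of the Jung--van der Kulk theorem in arbitrary characteristic.  For an automorphism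
  \<open>(F, G)\<close> with inverse \<open>(P, Q)\<close> give \<open>x\<close> and \<open>y\<close> the \<open>y\<close>-degrees of \<open>F\<close> and \<open>G\<close> as weights.  The
  additive group acts on the plane by \<open>Q \<mapsto> Q + s\<close> with \<open>P\<close> fixed; passing to leading forms gives a
  nontrivial pair \<open>X, Y\<close> of polynomials in \<open>s\<close> along which the leading form of \<open>P\<close> is constant.  The leading
  form of \<open>P\<close> vanishes at the leading coefficients of \<open>F\<close> and \<open>G\<close>, hence has a factor \<open>x\<^sup>a - c y\<^sup>b\<close> with
  \<open>c\<close> in \<open>K\<close>, which is then constant along \<open>X, Y\<close> too.  This is impossible if \<open>a, b \<ge> 2\<close>, so one of
  \<open>F - c G\<^sup>b\<close> and \<open>G - c F\<^sup>a\<close> has smaller degree.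

  Over \<open>K(t)\<close> the map \<open>\<beta>\<close> is multiplication by \<open>t\<close>.  If \<open>K\<close> contains \<open>k(t)\<close>, take a maximal subring \<open>R\<close>
  of \<open>K\<close> over which \<open>t\<close> is transcendental.  Then \<open>K\<close> is algebraic over \<open>R[t]\<close>, so \<open>R[t]\<close> and \<open>K[x]\<close> have
  the same cardinality, and \<open>\<beta>\<close> is obtained from bases over the prime field.
\<close>

section \<open>Ring homomorphisms and leading forms\<close>

definition ring_map :: "('a::comm_ring_1 \<Rightarrow> 'b::comm_ring_1) \<Rightarrow> bool" where
  "ring_map \<theta> \<longleftrightarrow> \<theta> 1 = 1 \<and> (\<forall>x y. \<theta> (x + y) = \<theta> x + \<theta> y) \<and> (\<forall>x y. \<theta> (x * y) = \<theta> x * \<theta> y)"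

lemma ring_mapD:
  assumes "ring_map \<theta>"
  shows "\<theta> 1 = 1" "\<theta> (x + y) = \<theta> x + \<theta> y" "\<theta> (x * y) = \<theta> x * \<theta> y" "\<theta> 0 = 0"
    "\<theta> (- x) = - \<theta> x" "\<theta> (x - y) = \<theta> x - \<theta> y" "\<theta> (x ^ n) = \<theta> x ^ n"
proof -
  show a: "\<theta> 1 = 1" "\<theta> (x + y) = \<theta> x + \<theta> y" "\<theta> (x * y) = \<theta> x * \<theta> y" for x y
    using assms by (auto simp: ring_map_def)
  show z: "\<theta> 0 = 0" using a(2)[of 0 0] by simp
  show m: "\<theta> (- x) = - \<theta> x" for x using a(2)[of x "- x"] z by (simp add: minus_unique)
  show "\<theta> (x - y) = \<theta> x - \<theta> y" using a(2)[of x "- y"] m by simp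
  show "\<theta> (x ^ n) = \<theta> x ^ n" by (induction n) (simp_all add: a)
qed

lemma ring_map_sum: "ring_map \<theta> \<Longrightarrow> \<theta> (sum f A) = (\<Sum>i\<in>A. \<theta> (f i))"
  by (induction A rule: infinite_finite_induct) (simp_all add: ring_mapD)

lemma ring_map_poly: "ring_map (\<lambda>p. poly p c)"
  by (simp add: ring_map_def)

lemma ring_map_const: "ring_map (\<lambda>c. [:c:])"
  by (simp add: ring_map_def)

lemma ring_map_comp: "ring_map \<theta> \<Longrightarrow> ring_map \<eta> \<Longrightarrow> ring_map (\<lambda>c. \<theta> (\<eta> c))"
  by (simp add: ring_map_def)

lemma ring_map_eval_map_poly:
  assumes "ring_map \<theta>"
  shows "ring_map (\<lambda>p. poly (map_poly \<theta> p) z)"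
  unfolding ring_map_def
  using ring_mapD[OF assms] by (simp add: eval_map_add eval_map_mult map_poly_1')

text \<open>A bound \<open>n\<close> in place of the degree allows two polynomials of different
  degrees to be summed over one range.\<close>

lemma poly_map_poly_altdef:
  assumes "\<theta> 0 = (0 :: 'b::comm_ring_1)" "degree p \<le> n"
  shows "poly (map_poly \<theta> p) z = (\<Sum>i\<le>n. \<theta> (coeff p i) * z ^ i)"
proof -
  have "poly (map_poly \<theta> p) z = (\<Sum>i\<le>degree (map_poly \<theta> p). \<theta> (coeff p i) * z ^ i)"
    by (simp add: poly_altdef coeff_map_poly assms)
  also have "\<dots> = (\<Sum>i\<le>n. \<theta> (coeff p i) * z ^ i)"
  proof (rule sum.mono_neutral_left)
    show "{..degree (map_poly \<theta> p)} \<subseteq> {..n}"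
      using map_poly_degree_leq[of \<theta> p] assms by auto
    show "\<forall>i\<in>{..n} - {..degree (map_poly \<theta> p)}. \<theta> (coeff p i) * z ^ i = 0"
    proof
      fix i assume "i \<in> {..n} - {..degree (map_poly \<theta> p)}"
      then have "coeff (map_poly \<theta> p) i = 0" by (intro coeff_eq_0) auto
      then show "\<theta> (coeff p i) * z ^ i = 0" by (simp add: coeff_map_poly assms)
    qed
  qed auto
  finally show ?thesis .
qed

text \<open>The free choice of target ring covers substitution, specialisation to one variable and
  passage to \<open>K[x,y][s]\<close>; ring homomorphisms between the targets relate these.\<close>

definition eval2 :: "('a::field \<Rightarrow> 'b::comm_ring_1) \<Rightarrow> 'a poly2 \<Rightarrow> 'b \<Rightarrow> 'b \<Rightarrow> 'b" where
  "eval2 \<theta> p u v = poly (map_poly (\<lambda>c. poly (map_poly \<theta> c) u) p) v"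

lemma ring_map_eval2: "ring_map \<theta> \<Longrightarrow> ring_map (\<lambda>p. eval2 \<theta> p u v)"
  unfolding eval2_def by (intro ring_map_eval_map_poly)

lemma eval2_gens:
  assumes "ring_map \<theta>"
  shows "eval2 \<theta> [:[:a:]:] u v = \<theta> a" "eval2 \<theta> poly2_x u v = u" "eval2 \<theta> poly2_y u v = v"
  using ring_mapD[OF assms]
  by (simp_all add: eval2_def poly2_x_def poly2_y_def map_poly_pCons map_poly_1' flip: one_pCons)

text \<open>Uniqueness in the universal property of \<open>K[x,y]\<close>, which is generated by the
  constants, \<open>x\<close> and \<open>y\<close>.\<close>

lemma ring_map_poly2_eqI:
  fixes f g :: "'a::field poly2 \<Rightarrow> 'b::comm_ring_1"
  assumes "ring_map f" "ring_map g" "\<And>a. f [:[:a:]:] = g [:[:a:]:]"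
    "f poly2_x = g poly2_x" "f poly2_y = g poly2_y"
  shows "f p = g p"
  by (induction p rule: poly2_induct) (simp_all add: assms ring_mapD)

lemma eval2_ring_map:
  assumes "ring_map \<theta>" "ring_map \<eta>"
  shows "\<eta> (eval2 \<theta> p u v) = eval2 (\<lambda>c. \<eta> (\<theta> c)) p (\<eta> u) (\<eta> v)"
  by (rule ring_map_poly2_eqI[of "\<lambda>p. \<eta> (eval2 \<theta> p u v)"])
     (use assms ring_map_comp[of \<eta>, OF assms(2) ring_map_eval2[OF assms(1)]] in
       \<open>simp_all add: ring_map_comp ring_map_eval2 eval2_gens\<close>)

lemma poly2_subst_eval2: "poly2_subst p \<psi> = eval2 (\<lambda>a. [:[:a:]:]) p (fst \<psi>) (snd \<psi>)"
  by (simp add: poly2_subst_def eval2_def)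

lemma ring_map_const2: "ring_map (\<lambda>a. [:[:a:]:])"
  by (intro ring_map_comp[OF ring_map_const] ring_map_const)

lemma ring_map_subst: "ring_map (\<lambda>p. poly2_subst p \<psi>)"
  unfolding poly2_subst_eval2 by (intro ring_map_eval2 ring_map_const2)

lemma eval2_subst:
  assumes "ring_map \<theta>"
  shows "eval2 \<theta> (poly2_subst p \<psi>) u v = eval2 \<theta> p (eval2 \<theta> (fst \<psi>) u v) (eval2 \<theta> (snd \<psi>) u v)"
  unfolding poly2_subst_eval2
  using eval2_ring_map[OF ring_map_const2 ring_map_eval2[OF assms], of p "fst \<psi>" "snd \<psi>" u v] assms
  by (simp add: eval2_gens)

text \<open>
  \<open>L n f f'\<close> is to be read as: all terms of \<open>f\<close> have weight at most \<open>n\<close>, and \<open>f'\<close> is the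
  part of \<open>f\<close> of weight \<open>n\<close>.
\<close>

locale graded =
  fixes L :: "real \<Rightarrow> 'r::comm_ring_1 \<Rightarrow> 'r \<Rightarrow> bool"
  assumes zero: "L n 0 0"
    and one: "L 0 1 1"
    and add: "L n f f' \<Longrightarrow> L n g g' \<Longrightarrow> L n (f + g) (f' + g')"
    and mult: "L n f f' \<Longrightarrow> L m g g' \<Longrightarrow> L (n + m) (f * g) (f' * g')"
    and unique: "L n f f' \<Longrightarrow> L n f f'' \<Longrightarrow> f' = f''"
    and strict: "L n f f' \<Longrightarrow> n < m \<Longrightarrow> L m f 0"
    and exists: "f \<noteq> 0 \<Longrightarrow> \<exists>n f'. f' \<noteq> 0 \<and> L n f f'"
begin

lemma sum: "(\<And>i. i \<in> A \<Longrightarrow> L n (f i) (f' i)) \<Longrightarrow> L n (sum f A) (sum f' A)"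
  by (induction A rule: infinite_finite_induct) (simp_all add: zero add)

lemma power: "L n f f' \<Longrightarrow> L (n * real k) (f ^ k) (f' ^ k)"
proof (induction k)
  case 0
  show ?case by (simp add: one)
next
  case (Suc k)
  then have "L (n + n * real k) (f * f ^ k) (f' * f' ^ k)" by (intro mult) auto
  then show ?case by (simp add: algebra_simps)
qed

end

text \<open>Constants carry weight 0; the gradings of the polynomial rings are built on this
  base.\<close>

definition lead_const :: "real \<Rightarrow> 'a::field \<Rightarrow> 'a \<Rightarrow> bool" where
  "lead_const n c c' \<longleftrightarrow> (n < 0 \<longrightarrow> c = 0) \<and> c' = (if n = 0 then c else 0)"

text \<open>Adjoins a variable of weight \<open>\<sigma>\<close> to a graded ring: twice for
  \<open>K[x,y]\<close>, a third time for \<open>K[x,y][s]\<close>.\<close>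

definition lead_poly :: "real \<Rightarrow> (real \<Rightarrow> 'r::comm_ring_1 \<Rightarrow> 'r \<Rightarrow> bool) \<Rightarrow> real \<Rightarrow> 'r poly \<Rightarrow> 'r poly \<Rightarrow> bool" where
  "lead_poly \<sigma> L n f f' \<longleftrightarrow> (\<forall>i. L (n - \<sigma> * real i) (coeff f i) (coeff f' i))"

lemma graded_lead_const: "graded lead_const"
proof
  fix f :: 'a assume "f \<noteq> 0"
  then show "\<exists>n f'. f' \<noteq> 0 \<and> lead_const n f f'"
    by (intro exI[of _ 0] exI[of _ f]) (simp add: lead_const_def)
qed (auto simp: lead_const_def split: if_splits)

context graded
begin

text \<open>By uniqueness the leading part of a vanishing coefficient is 0, so parts chosen
  coefficientwise have finite support and form a polynomial.\<close>

lemma lead_poly_exI: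
  assumes "\<And>i. \<exists>h. L (n - \<sigma> * real i) (coeff f i) h"
  shows "\<exists>f'. lead_poly \<sigma> L n f f'"
proof -
  obtain H where H: "\<And>i. L (n - \<sigma> * real i) (coeff f i) (H i)" using assms by metis
  have "H i = 0" if "i > degree f" for i
    using unique[OF H[of i]] zero that by (simp add: coeff_eq_0)
  then have "coeff (Abs_poly H) = H"
    by (intro coeff_Abs_poly) auto
  with H show ?thesis unfolding lead_poly_def by (intro exI[of _ "Abs_poly H"]) simp
qed

lemma graded_lead_poly: "graded (lead_poly \<sigma> L)"
proof
  fix f f' g g' :: "'r poly" and n m :: real
  assume f: "lead_poly \<sigma> L n f f'"
  {
    assume g: "lead_poly \<sigma> L m g g'"
    show "lead_poly \<sigma> L (n + m) (f * g) (f' * g')"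
      unfolding lead_poly_def coeff_mult
    proof (intro allI sum)
      fix i k :: nat assume "k \<in> {..i}"
      then have "(n + m - \<sigma> * real i) = (n - \<sigma> * real k) + (m - \<sigma> * real (i - k))"
        by (simp add: of_nat_diff algebra_simps)
      then show "L (n + m - \<sigma> * real i) (coeff f k * coeff g (i - k)) (coeff f' k * coeff g' (i - k))"
        using f g mult unfolding lead_poly_def by metis
    qed
  next
    assume "n < m"
    then show "lead_poly \<sigma> L m f 0"
      using f strict unfolding lead_poly_def by (metis coeff_0 diff_strict_right_mono)
  next
    assume "lead_poly \<sigma> L n f g'"
    then show "f' = g'" using f unique unfolding lead_poly_def by (metis poly_eqI)
  next
    assume "lead_poly \<sigma> L n g g'"
    then show "lead_poly \<sigma> L n (f + g) (f' + g')" using f add unfolding lead_poly_def by simp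
  }
next
  show "lead_poly \<sigma> L n 0 0" for n by (simp add: lead_poly_def zero)
  show "lead_poly \<sigma> L 0 1 1" by (auto simp: lead_poly_def zero one coeff_1)
next
  fix f :: "'r poly" assume "f \<noteq> 0"
  define I where "I = {i. coeff f i \<noteq> 0}"
  have "finite I" unfolding I_def using MOST_coeff_eq_0[of f] by (simp add: eventually_cofinite)
  have "I \<noteq> {}" unfolding I_def using \<open>f \<noteq> 0\<close> leading_coeff_neq_0 by blast
  obtain N H where NH: "\<And>i. i \<in> I \<Longrightarrow> H i \<noteq> 0 \<and> L (N i) (coeff f i) (H i)"
    using exists[of "coeff f _"] unfolding I_def mem_Collect_eq by metis
  \<comment> \<open>The greatest weight of a term. At an index \<open>i0\<close> where it is
    attained, the leading part keeps a nonzero coefficient.\<close>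
  define n where "n = Max ((\<lambda>i. N i + \<sigma> * real i) ` I)"
  have "n \<in> (\<lambda>i. N i + \<sigma> * real i) ` I"
    unfolding n_def using \<open>finite I\<close> \<open>I \<noteq> {}\<close> by (intro Max_in) auto
  then obtain i0 where i0: "i0 \<in> I" "n = N i0 + \<sigma> * real i0" by auto
  have "\<exists>h. L (n - \<sigma> * real i) (coeff f i) h" for i
  proof (cases "i \<in> I")
    case True
    have "N i + \<sigma> * real i \<le> n" unfolding n_def using \<open>finite I\<close> True by simp
    then consider "N i = n - \<sigma> * real i" | "N i < n - \<sigma> * real i" by linarith
    then show ?thesis using NH[OF True] strict by cases metis+
  next
    case False
    then show ?thesis unfolding I_def using zero by auto
  qed
  then obtain f' where f': "lead_poly \<sigma> L n f f'" using lead_poly_exI by blast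
  then have "L (N i0) (coeff f i0) (coeff f' i0)"
    unfolding lead_poly_def using i0(2) by (metis add_diff_cancel_right')
  then have "coeff f' i0 = H i0" using NH[OF i0(1)] unique by blast
  then have "f' \<noteq> 0" using NH[OF i0(1)] by auto
  with f' show "\<exists>n f'. f' \<noteq> 0 \<and> lead_poly \<sigma> L n f f'" by blast
qed

text \<open>A coefficient of weight at most \<open>n - w * i\<close> meets \<open>Z ^ i\<close> of
  weight at most \<open>w * i\<close>, so every term has weight at most \<open>n\<close>. The
  leading parts may cancel to 0, which is how relations between leading forms arise.\<close>

lemma lead_poly_eval:
  fixes M :: "real \<Rightarrow> 'b::comm_ring_1 \<Rightarrow> 'b \<Rightarrow> bool"
  assumes M: "\<And>n c c'. M n c c' \<Longrightarrow> L n (\<theta> c) (\<theta>' c')" and Z: "L w Z Z'"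
    and 0: "\<theta> 0 = 0" "\<theta>' 0 = 0" and f: "lead_poly w M n f f'"
  shows "L n (poly (map_poly \<theta> f) Z) (poly (map_poly \<theta>' f') Z')"
proof -
  define N where "N = max (degree f) (degree f')"
  have "L n (\<Sum>i\<le>N. \<theta> (coeff f i) * Z ^ i) (\<Sum>i\<le>N. \<theta>' (coeff f' i) * Z' ^ i)"
  proof (rule sum)
    fix i
    have "L ((n - w * real i) + w * real i) (\<theta> (coeff f i) * Z ^ i) (\<theta>' (coeff f' i) * Z' ^ i)"
      using f M power[OF Z] unfolding lead_poly_def by (intro mult) auto
    then show "L n (\<theta> (coeff f i) * Z ^ i) (\<theta>' (coeff f' i) * Z' ^ i)" by simp
  qed
  then show ?thesis by (simp add: poly_map_poly_altdef[where n = N] 0 N_def)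
qed

end

definition lead2 :: "real \<Rightarrow> real \<Rightarrow> real \<Rightarrow> 'a::field poly2 \<Rightarrow> 'a poly2 \<Rightarrow> bool" where
  "lead2 wx wy = lead_poly wy (lead_poly wx lead_const)"

lemma graded_lead2: "graded (lead2 wx wy)"
  unfolding lead2_def by (intro graded.graded_lead_poly graded_lead_const)

lemma lead_poly_gens:
  assumes "graded L" "L n c c'"
  shows "lead_poly \<sigma> L n [:c:] [:c':]" "lead_poly \<sigma> L \<sigma> [:0, 1:] [:0, 1:]"
  using assms graded.zero[OF assms(1)] graded.one[OF assms(1)]
  by (auto simp: lead_poly_def coeff_pCons split: nat.splits)

lemma lead2_coeffD:
  assumes "lead2 wx wy n f f'" "coeff (coeff f' k) j \<noteq> 0"
  shows "real j * wx + real k * wy = n"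
  using assms unfolding lead2_def lead_poly_def lead_const_def
  by (smt (verit) mult.commute)

lemma lead2_gens:
  fixes c :: "'a::field"
  shows "lead2 wx wy 0 [:[:c:]:] [:[:c:]:]" "lead2 wx wy wx poly2_x (poly2_x :: 'a poly2)"
    "lead2 wx wy wy poly2_y (poly2_y :: 'a poly2)"
proof -
  have c: "lead_const 0 c c" for c :: 'a by (simp add: lead_const_def)
  note g = graded_lead_const and gx = graded.graded_lead_poly[OF graded_lead_const, of wx]
  show "lead2 wx wy 0 [:[:c:]:] [:[:c:]:]" "lead2 wx wy wx poly2_x (poly2_x :: 'a poly2)"
    "lead2 wx wy wy poly2_y (poly2_y :: 'a poly2)"
    unfolding lead2_def poly2_x_def poly2_y_def
    using lead_poly_gens(1)[OF gx lead_poly_gens(1)[OF g c]]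
      lead_poly_gens(1)[OF gx lead_poly_gens(2)[OF g c]] lead_poly_gens(2)[OF gx lead_poly_gens(1)[OF g c]]
    by auto
qed

lemma (in graded) lead2_eval2:
  assumes \<theta>: "ring_map (\<theta> :: 'a::field \<Rightarrow> 'r)" "\<And>c. L 0 (\<theta> c) (\<theta> c)" and UV: "L wx U U'" "L wy V V'"
    and p: "lead2 wx wy n p p'"
  shows "L n (eval2 \<theta> p U V) (eval2 \<theta> p' U' V')"
  unfolding eval2_def
proof (rule lead_poly_eval[OF _ UV(2)])
  show "lead_poly wy (lead_poly wx lead_const) n p p'" using p unfolding lead2_def .
  fix n and c c' :: "'a poly" assume c: "lead_poly wx lead_const n c c'"
  \<comment> \<open>A constant has a nonzero leading part only in weight 0: in positive weight
    \<open>strict\<close> gives the part 0, and in negative weight the constant itself is 0.\<close>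
  have "L n (\<theta> a) (\<theta> a')" if "lead_const n a a'" for n a a'
    using that \<theta>(2)[of a] strict[OF \<theta>(2)[of a], of n] zero ring_mapD(4)[OF \<theta>(1)]
    unfolding lead_const_def by (cases "n = 0"; cases "n < 0") auto
  then show "L n (poly (map_poly \<theta> c) U) (poly (map_poly \<theta> c') U')"
    by (intro lead_poly_eval[OF _ UV(1) _ _ c]) (simp_all add: ring_mapD[OF \<theta>(1)])
qed (use ring_mapD[OF \<theta>(1)] in simp_all)

section \<open>Quasi-homogeneous forms and binomials\<close>

text \<open>The homogenization \<open>v ^ n * f (u / v)\<close>, written without division.\<close>

definition homog :: "('a::field \<Rightarrow> 'b::comm_ring_1) \<Rightarrow> nat \<Rightarrow> 'a poly \<Rightarrow> 'b \<Rightarrow> 'b \<Rightarrow> 'b" where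
  "homog \<theta> n f u v = (\<Sum>l\<le>n. \<theta> (coeff f l) * u ^ l * v ^ (n - l))"

lemma homog_ring_map:
  assumes "ring_map \<eta>"
  shows "\<eta> (homog \<theta> n f u v) = homog (\<lambda>c. \<eta> (\<theta> c)) n f (\<eta> u) (\<eta> v)"
  unfolding homog_def by (simp add: assms ring_map_sum ring_mapD)

lemma homog_linear_factor:
  assumes "ring_map \<theta>" "degree f \<le> n"
  shows "homog \<theta> (Suc n) ([:- c, 1:] * f) u v = (u - \<theta> c * v) * homog \<theta> n f u v"
proof -
  have "homog \<theta> (Suc n) ([:- c, 1:] * f) u v
      = (\<Sum>l\<le>Suc n. \<theta> (coeff (pCons 0 f) l) * u ^ l * v ^ (Suc n - l))
        - (\<Sum>l\<le>Suc n. \<theta> c * \<theta> (coeff f l) * u ^ l * v ^ (Suc n - l))"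
    unfolding homog_def sum_subtractf[symmetric]
    by (rule sum.cong) (simp_all add: ring_mapD[OF assms(1)] algebra_simps)
  also have "(\<Sum>l\<le>Suc n. \<theta> (coeff (pCons 0 f) l) * u ^ l * v ^ (Suc n - l)) = u * homog \<theta> n f u v"
    unfolding homog_def sum.atMost_Suc_shift
    by (simp add: ring_mapD[OF assms(1)] sum_distrib_left algebra_simps)
  also have "(\<Sum>l\<le>Suc n. \<theta> c * \<theta> (coeff f l) * u ^ l * v ^ (Suc n - l))
      = (\<Sum>l\<le>n. \<theta> c * \<theta> (coeff f l) * u ^ l * v ^ (Suc n - l))"
    using assms(2) by (simp add: coeff_eq_0 ring_mapD[OF assms(1)])
  also have "\<dots> = \<theta> c * v * homog \<theta> n f u v"
    unfolding homog_def sum_distrib_left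
    by (rule sum.cong) (simp_all add: Suc_diff_le)
  finally show ?thesis by (simp add: algebra_simps)
qed

text \<open>With bounds instead of degrees both sides are 0 when a bound is not attained, so
  polynomials of different degrees can be compared at one common index.\<close>

lemma coeff_mult_degree_le:
  assumes "degree p \<le> m" "degree q \<le> n"
  shows "coeff (p * q) (m + n) = coeff p m * coeff q n"
proof (cases "degree p = m \<and> degree q = n")
  case True
  then show ?thesis using coeff_mult_degree_sum by blast
next
  case False
  then have "degree p < m \<or> degree q < n" using assms by auto
  moreover have "degree (p * q) < m + n" using degree_mult_le[of p q] assms calculation by linarith
  ultimately show ?thesis by (auto simp: coeff_eq_0)
qed

lemma coeff_power_degree_le:
  assumes "degree p \<le> m"
  shows "degree (p ^ k) \<le> k * m" "coeff (p ^ k) (k * m) = coeff p m ^ k"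
proof (induction k)
  case (Suc k)
  { case 1 show ?case using degree_mult_le[of p "p ^ k"] Suc.IH(1) assms by simp
  next
    case 2 show ?case using coeff_mult_degree_le[OF assms Suc.IH(1)] Suc.IH(2) by simp }
qed auto

text \<open>Comparing coefficients at \<open>n * d\<close>, for \<open>d\<close> the larger of the
  degrees of \<open>u\<close> and \<open>v\<close>, gives a homogeneous relation over the field
  between their coefficients \<open>\<alpha>\<close> and \<open>\<beta>\<close> at \<open>d\<close>.
  The leading coefficient of \<open>f\<close> excludes \<open>\<beta> = 0\<close>, and
  \<open>\<alpha> / \<beta>\<close> is a root.\<close>

lemma homog_eq_0_root:
  fixes f :: "'a::field poly" and u v :: "'a poly"
  assumes "u \<noteq> 0" "degree f = n" "coeff f 0 \<noteq> 0" "homog (\<lambda>c. [:c:]) n f u v = 0"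
  shows "\<exists>c. poly f c = 0"
proof -
  define d where "d = max (degree u) (degree v)"
  define \<alpha> \<beta> where "\<alpha> = coeff u d" and "\<beta> = coeff v d"
  have "\<alpha> \<noteq> 0 \<or> \<beta> \<noteq> 0"
    using assms(1) unfolding \<alpha>_def \<beta>_def d_def
    by (metis degree_0 leading_coeff_neq_0 max_def max_0R zero_le bot_nat_0.extremum_uniqueI)
  have fn: "coeff f n \<noteq> 0" using assms(2,3) by (metis coeff_0 leading_coeff_0_iff)
  have "0 = coeff (homog (\<lambda>c. [:c:]) n f u v) (n * d)" by (simp add: assms)
  also have "\<dots> = (\<Sum>l\<le>n. coeff f l * \<alpha> ^ l * \<beta> ^ (n - l))"
    unfolding homog_def coeff_sum
  proof (rule sum.cong)
    fix l assume "l \<in> {..n}"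
    then have "n * d = l * d + (n - l) * d" by (simp add: add_mult_distrib[symmetric])
    then have "coeff (u ^ l * v ^ (n - l)) (n * d) = \<alpha> ^ l * \<beta> ^ (n - l)"
      using coeff_mult_degree_le coeff_power_degree_le[of u d] coeff_power_degree_le[of v d]
      unfolding \<alpha>_def \<beta>_def d_def by (metis max.cobounded1 max.cobounded2)
    then show "coeff ([:coeff f l:] * u ^ l * v ^ (n - l)) (n * d) = coeff f l * \<alpha> ^ l * \<beta> ^ (n - l)"
      by (simp add: mult.assoc)
  qed simp
  finally have eq: "(\<Sum>l\<le>n. coeff f l * \<alpha> ^ l * \<beta> ^ (n - l)) = 0" by simp
  have "\<beta> \<noteq> 0"
  proof
    assume "\<beta> = 0"
    then have "(\<Sum>l\<le>n. coeff f l * \<alpha> ^ l * \<beta> ^ (n - l)) = (\<Sum>l\<in>{n}. coeff f l * \<alpha> ^ l * \<beta> ^ (n - l))"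
      by (intro sum.mono_neutral_right) auto
    then show False using eq fn \<open>\<beta> = 0\<close> \<open>\<alpha> \<noteq> 0 \<or> \<beta> \<noteq> 0\<close> by simp
  qed
  have "poly f (\<alpha> / \<beta>) * \<beta> ^ n = (\<Sum>l\<le>n. coeff f l * \<alpha> ^ l * \<beta> ^ (n - l))"
    unfolding poly_altdef assms(2) sum_distrib_right
    by (rule sum.cong) (use \<open>\<beta> \<noteq> 0\<close> in \<open>auto simp: power_divide field_simps simp flip: power_add\<close>)
  then show ?thesis using eq \<open>\<beta> \<noteq> 0\<close> by auto
qed

text \<open>In other words: \<open>K\<close> is algebraically closed in \<open>K(x)\<close>.\<close>

lemma homog_eq_0:
  fixes f :: "'a::field poly" and u v :: "'a poly"
  assumes "u \<noteq> 0" "degree f = n" "coeff f 0 \<noteq> 0" "homog (\<lambda>c. [:c:]) n f u v = 0"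
  shows "\<exists>c. poly f c = 0 \<and> c \<noteq> 0 \<and> u = smult c v"
  using assms
proof (induction n arbitrary: f)
  case 0
  then show ?case by (simp add: homog_def)
next
  case (Suc n)
  obtain c where c: "poly f c = 0" using homog_eq_0_root[OF Suc.prems] by blast
  then obtain g where g: "f = [:- c, 1:] * g" unfolding poly_eq_0_iff_dvd by (auto elim: dvdE)
  have "g \<noteq> 0" using g Suc.prems(2) by auto
  then have dg: "degree g = n"
    using Suc.prems(2) degree_mult_eq[of "[:- c, 1:]" g] unfolding g by simp
  have cg: "c \<noteq> 0" "coeff g 0 \<noteq> 0" using Suc.prems(3) unfolding g by (auto simp: coeff_mult)
  have "(u - [:c:] * v) * homog (\<lambda>c. [:c:]) n g u v = 0"
    using Suc.prems(4) homog_linear_factor[OF ring_map_const, of g n c u v] dg unfolding g by simp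
  then consider "u = smult c v" | "homog (\<lambda>c. [:c:]) n g u v = 0" by auto
  then show ?case
  proof cases
    case 1
    then show ?thesis using c cg by blast
  next
    case 2
    from Suc.IH[OF \<open>u \<noteq> 0\<close> dg cg(2) this] show ?thesis unfolding g by auto
  qed
qed

lemma coeff_monom_xy:
  "coeff (coeff ([:[:c:]:] * poly2_x ^ i * poly2_y ^ j) k) l = (if k = j \<and> l = i then c else 0)"
proof -
  have x: "poly2_x ^ i = [:monom (1::'a) i:]"
    by (induction i) (auto simp: poly2_x_def monom_Suc one_pCons)
  have y: "poly2_y ^ j = (monom 1 j :: 'a poly2)"
    unfolding poly2_y_def by (metis monom_altdef mult_1 one_pCons smult_1_left)
  show ?thesis unfolding x y by (auto simp: coeff_monom_mult smult_monom mult.commute)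
qed

text \<open>As \<open>a\<close> and \<open>b\<close> are coprime, exponent pairs of equal weight
  differ by multiples of \<open>(a, - b)\<close>. Counted from the least exponent \<open>i\<close>
  of \<open>x\<close>, the terms sit at \<open>(i + a * l, k0 - b * l)\<close>, and \<open>g\<close>
  collects their coefficients.\<close>

lemma quasihomogeneous_form:
  fixes f :: "'a::field poly2"
  assumes "f \<noteq> 0" and ab: "coprime a b" "a > 0" "b > 0"
    and hom: "\<And>j k. coeff (coeff f k) j \<noteq> 0 \<Longrightarrow> real j * real b + real k * real a = D"
  shows "\<exists>i j n g. degree g = n \<and> coeff g 0 \<noteq> 0 \<and>
    f = poly2_x ^ i * poly2_y ^ j * homog (\<lambda>c. [:[:c:]:]) n g (poly2_x ^ a) (poly2_y ^ b)"
proof -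
  define M where "M = {j. \<exists>k. coeff (coeff f k) j \<noteq> 0}"
  define i where "i = (LEAST j. j \<in> M)"
  have "\<exists>j. j \<in> M" unfolding M_def mem_Collect_eq
    using \<open>f \<noteq> 0\<close> by (metis leading_coeff_neq_0)
  then have "i \<in> M" unfolding i_def by (meson LeastI_ex)
  then obtain k0 where k0: "coeff (coeff f k0) i \<noteq> 0" unfolding M_def by auto
  have supp: "\<exists>l. j = i + a * l \<and> k0 = k + b * l" if "coeff (coeff f k) j \<noteq> 0" for j k
  proof -
    have "i \<le> j" unfolding i_def using that by (intro Least_le) (auto simp: M_def)
    have "real (j * b + k * a) = real (i * b + k0 * a)" using hom[OF that] hom[OF k0] by simp
    then have eq: "j * b + k * a = i * b + k0 * a" by (simp only: of_nat_eq_iff)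
    have "k \<le> k0"
    proof (rule ccontr)
      assume "\<not> k \<le> k0"
      then have "i * b + k0 * a < j * b + k * a"
        using \<open>i \<le> j\<close> ab by (intro add_le_less_mono) auto
      with eq show False by simp
    qed
    obtain s t where st: "j = i + s" "k0 = k + t" using \<open>i \<le> j\<close> \<open>k \<le> k0\<close> le_Suc_ex by metis
    have "s * b = t * a" using eq unfolding st by (simp add: algebra_simps)
    then have "a dvd s * b" by simp
    then obtain l where l: "s = a * l" using ab(1) coprime_dvd_mult_left_iff by (metis dvdE)
    then have "t = b * l" using \<open>s * b = t * a\<close> ab by (simp add: mult.commute)
    with l st show ?thesis by auto
  qed
  \<comment> \<open>The condition \<open>b * l \<le> k0\<close> rules out indices at which the
    natural subtraction would be truncated.\<close>
  define S where "S = {l. b * l \<le> k0 \<and> coeff (coeff f (k0 - b * l)) (i + a * l) \<noteq> 0}"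
  have finS: "finite S"
    by (rule finite_subset[of _ "{..k0}"]) (use ab in \<open>auto simp: S_def intro: order_trans[rotated]\<close>)
  have "0 \<in> S" using k0 by (simp add: S_def)
  define n where "n = Max S"
  have nS: "n \<in> S" unfolding n_def using finS \<open>0 \<in> S\<close> by (intro Max_in) auto
  have maxS: "l \<le> n" if "l \<in> S" for l unfolding n_def using finS that by simp
  define c where "c l = coeff (coeff f (k0 - b * l)) (i + a * l)" for l
  define g where "g = (\<Sum>l\<le>n. monom (c l) l)"
  have cg: "coeff g l = (if l \<le> n then c l else 0)" for l
    unfolding g_def by (simp add: coeff_sum)
  have "c n \<noteq> 0" using nS by (simp add: S_def c_def)
  then have dg: "degree g = n"
    by (intro antisym degree_le le_degree) (auto simp: cg)
  \<comment> \<open>The last occupied index \<open>n\<close> has the least exponent of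
    \<open>y\<close>, so this power of \<open>y\<close> can be taken out.\<close>
  define j where "j = k0 - b * n"
  have bn: "b * n \<le> k0" using nS by (simp add: S_def)
  let ?h = "poly2_x ^ i * poly2_y ^ j * homog (\<lambda>c. [:[:c:]:]) n g (poly2_x ^ a) (poly2_y ^ b)"
  have h: "?h = (\<Sum>l\<le>n. [:[:c l:]:] * poly2_x ^ (i + a * l) * poly2_y ^ (k0 - b * l))"
    unfolding homog_def sum_distrib_left
  proof (rule sum.cong)
    fix l assume l: "l \<in> {..n}"
    have "b * n = b * l + b * (n - l)" using l by (simp add: add_mult_distrib2[symmetric])
    then have "k0 - b * l = j + b * (n - l)" using bn unfolding j_def by simp
    then show "poly2_x ^ i * poly2_y ^ j * ([:[:coeff g l:]:] * (poly2_x ^ a) ^ l * (poly2_y ^ b) ^ (n - l))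
        = [:[:c l:]:] * poly2_x ^ (i + a * l) * poly2_y ^ (k0 - b * l)"
      using l by (simp only: cg power_add power_mult) (simp add: mult_ac)
  qed simp
  have "coeff (coeff f k) m = coeff (coeff ?h k) m" for k m
  proof -
    have *: "coeff (coeff ?h k) m = (\<Sum>l\<le>n. if k = k0 - b * l \<and> m = i + a * l then c l else 0)"
      unfolding h coeff_sum coeff_monom_xy by simp
    show ?thesis
    proof (cases "\<exists>l\<le>n. k = k0 - b * l \<and> m = i + a * l")
      case True
      then obtain l where l: "l \<le> n" "k = k0 - b * l" "m = i + a * l" by blast
      have "coeff (coeff ?h k) m = (\<Sum>l'\<le>n. if l' = l then c l else 0)"
        unfolding * using l ab by (intro sum.cong) auto
      also have "\<dots> = c l" using l by simp
      finally show ?thesis using l by (simp add: c_def)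
    next
      case False
      then have 0: "coeff (coeff ?h k) m = 0" unfolding * by (intro sum.neutral) auto
      show ?thesis
      proof (rule ccontr)
        assume "coeff (coeff f k) m \<noteq> coeff (coeff ?h k) m"
        then have nz: "coeff (coeff f k) m \<noteq> 0" using 0 by simp
        then obtain l where l: "m = i + a * l" "k0 = k + b * l" using supp by blast
        with nz have "l \<in> S" by (simp add: S_def)
        moreover have "k = k0 - b * l" using l(2) by simp
        ultimately show False using False l(1) maxS by blast
      qed
    qed
  qed
  then have "f = ?h" by (intro poly_eqI)
  moreover have "coeff g 0 \<noteq> 0" using k0 by (simp add: cg c_def)
  ultimately show ?thesis using dg by blast
qed

section \<open>Sums of two powers that are constant along a curve\<close>

text \<open>Only exponents divisible by the characteristic survive. In characteristic 0 this leaves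
  the exponent 0 alone, in agreement with composition with the constant
  \<open>monom 1 0\<close>.\<close>

lemma pderiv_eq_0_pcompose:
  fixes p :: "'b::idom poly"
  assumes "pderiv p = 0"
  shows "\<exists>q. p = pcompose q (monom 1 CHAR('b))"
proof -
  let ?m = "monom (1::'b) CHAR('b)"
  have *: "monom (coeff p i) i = pcompose (monom (coeff p i) (i div CHAR('b))) ?m" for i
  proof (cases "coeff p i = 0")
    case False
    have "of_nat i * coeff p i = 0"
      using assms coeff_pderiv[of p "i - 1"] by (cases i) auto
    then have "CHAR('b) dvd i" using False by (simp add: of_nat_eq_0_iff_char_dvd)
    moreover have "pcompose (monom c k) ?m = monom c (CHAR('b) * k)" for c k
      by (induction k) (simp_all add: monom_0 monom_Suc pcompose_pCons mult_monom)
    ultimately show ?thesis by simp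
  qed simp
  have "p = (\<Sum>i\<le>degree p. monom (coeff p i) i)" by (simp add: poly_as_sum_of_monoms)
  also have "\<dots> = pcompose (\<Sum>i\<le>degree p. monom (coeff p i) (i div CHAR('b))) ?m"
    unfolding pcompose_sum by (intro sum.cong *) simp
  finally show ?thesis by blast
qed

text \<open>A degree argument in the style of Mason and Stothers: if a derivative is nonzero, then
  \<open>(a - 1) * degree X < degree Y\<close> and \<open>(b - 1) * degree Y < degree X\<close>,
  which is impossible for \<open>a, b \<ge> 2\<close>. If both derivatives vanish in characteristic
  \<open>p > 0\<close>, then \<open>X\<close> and \<open>Y\<close> are polynomials in the
  \<open>p\<close>-th power of the variable and the induction descends.\<close>

lemma power_sum_const_separable:
  fixes X Y :: "'b::idom poly"
  assumes "[:c:] * X ^ a + [:d:] * Y ^ b = [:h:]" "h \<noteq> 0" "c \<noteq> 0" "d \<noteq> 0" "a \<ge> 2" "b \<ge> 2"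
    "of_nat a \<noteq> (0::'b)" "of_nat b \<noteq> (0::'b)"
  shows "degree X = 0 \<and> degree Y = 0"
  using assms(1)
proof (induction "degree X + degree Y" arbitrary: X Y rule: less_induct)
  case less
  have pow: "Z ^ n = Z ^ (n - 1) * Z" if "n \<ge> 2" for Z :: "'b poly" and n
    using that by (cases n) simp_all
  have "pderiv ([:c:] * X ^ a + [:d:] * Y ^ b) = 0" using less.prems by (simp add: pderiv_pCons)
  then have der: "smult c (smult (of_nat a) (X ^ (a - 1) * pderiv X))
      + smult d (smult (of_nat b) (Y ^ (b - 1) * pderiv Y)) = 0"
    using assms(5,6) pderiv_power_Suc[of X "a - 1"] pderiv_power_Suc[of Y "b - 1"]
    by (simp add: pderiv_add pderiv_smult)
  show ?case
  proof (cases "pderiv X = 0 \<and> pderiv Y = 0")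
    case True
    let ?p = "CHAR('b)" and ?m = "monom (1::'b) CHAR('b)"
    obtain X' Y' where XY: "X = pcompose X' ?m" "Y = pcompose Y' ?m"
      using True pderiv_eq_0_pcompose by metis
    have dm: "degree ?m = ?p" by (simp add: degree_monom_eq)
    show ?thesis
    proof (cases "?p = 0")
      case True
      then show ?thesis unfolding XY by (simp add: degree_pcompose degree_monom_eq)
    next
      case False
      have "?p \<noteq> 1" using of_nat_CHAR[where 'a = 'b] by (metis of_nat_1 zero_neq_one)
      with False have p2: "?p \<ge> 2" by linarith
      have "pcompose ([:c:] * X' ^ a + [:d:] * Y' ^ b - [:h:]) ?m = 0"
        using less.prems ring_mapD(7)[of "\<lambda>p. pcompose p ?m"]
        unfolding XY pcompose_diff pcompose_add pcompose_mult pcompose_const ring_map_def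
        by (simp add: pcompose_add pcompose_mult pcompose_1)
      then have eq: "[:c:] * X' ^ a + [:d:] * Y' ^ b = [:h:]"
        using False by (auto dest!: pcompose_eq_0 simp: dm)
      have deg: "degree X = degree X' * ?p" "degree Y = degree Y' * ?p"
        unfolding XY by (simp_all add: degree_pcompose dm)
      show ?thesis
      proof (cases "degree X' + degree Y' = 0")
        case False
        then have "degree X' + degree Y' < degree X + degree Y"
          using p2 unfolding deg add_mult_distrib[symmetric] by simp
        from less.hyps[OF this eq] show ?thesis using deg by simp
      qed (use deg in simp)
    qed
  next
    case False
    txt \<open>The derivative of the relation shows that \<open>X ^ (a - 1)\<close> divides \<open>pderiv Y\<close> and
      \<open>Y ^ (b - 1)\<close> divides \<open>pderiv X\<close>, up to constants.\<close>
    have deg: "degree (Z ^ (n - 1)) < degree W"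
      if "[:e:] * Z ^ n + [:e':] * W ^ m = [:h:]" "pderiv Z \<noteq> 0 \<or> pderiv W \<noteq> 0" "n \<ge> 2" "m \<ge> 2"
        "smult e (smult (of_nat n) (Z ^ (n - 1) * pderiv Z))
          + smult e' (smult (of_nat m) (W ^ (m - 1) * pderiv W)) = 0"
        "e \<noteq> 0" "e' \<noteq> 0" "of_nat n \<noteq> (0::'b)" "of_nat m \<noteq> (0::'b)" for e e' n m and Z W :: "'b poly"
    proof -
      have W': "pderiv W \<noteq> 0"
      proof
        assume 0: "pderiv W = 0"
        then have "Z ^ (n - 1) * pderiv Z = 0" using that by simp
        then show False using 0 that(2) by auto
      qed
      have W: "Z ^ (n - 1) dvd smult (h * of_nat m) (pderiv W)"
      proof
        \<comment> \<open>The relation replaces \<open>h\<close>, and its derivative replaces the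
          term with \<open>W ^ (m - 1) * pderiv W\<close>; every summand then contains
          \<open>Z ^ (n - 1)\<close>.\<close>
        have "smult (h * of_nat m) (pderiv W) = [:h:] * smult (of_nat m) (pderiv W)"
          by (simp add: mult.commute)
        also have "\<dots> = smult e (smult (of_nat m) (Z ^ (n - 1) * Z * pderiv W))
            + W * smult e' (smult (of_nat m) (W ^ (m - 1) * pderiv W))"
          unfolding that(1)[symmetric] pow[OF that(3), of Z] pow[OF that(4), of W]
          by (simp add: algebra_simps smult_add_right)
        also have "smult e' (smult (of_nat m) (W ^ (m - 1) * pderiv W))
            = - smult e (smult (of_nat n) (Z ^ (n - 1) * pderiv Z))"
          using that(5) by (simp add: add_eq_0_iff)
        finally show "smult (h * of_nat m) (pderiv W)
            = Z ^ (n - 1) * (smult e (smult (of_nat m) (Z * pderiv W)) - smult e (smult (of_nat n) (W * pderiv Z)))"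
          by (simp add: algebra_simps)
      qed
      then have "degree (Z ^ (n - 1)) \<le> degree (smult (h * of_nat m) (pderiv W))"
        using W' that assms(2) by (intro dvd_imp_degree_le) auto
      also have "\<dots> \<le> degree W - 1"
      proof -
        have "degree (pderiv W) \<le> degree W - 1"
          by (rule degree_le) (auto simp: coeff_pderiv coeff_eq_0)
        then show ?thesis using that assms(2) by simp
      qed
      also have "\<dots> < degree W"
        using W' by (cases "degree W") (auto elim!: degree_eq_zeroE simp: pderiv_pCons)
      finally show ?thesis .
    qed
    have "degree (X ^ (a - 1)) < degree Y"
      using less.prems False der assms by (intro deg[of c X a d Y b]) auto
    moreover have "degree (Y ^ (b - 1)) < degree X"
      using less.prems False der assms by (intro deg[of d Y b c X a]) (auto simp: add.commute)
    moreover have "degree Z \<le> degree (Z ^ (n - 1))" if "n \<ge> 2" for Z :: "'b poly" and n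
      using that degree_power_eq[of Z "n - 1"] mult_le_mono1[of 1 "n - 1" "degree Z"]
      by (cases "Z = 0") auto
    then have "degree X \<le> degree (X ^ (a - 1))" "degree Y \<le> degree (Y ^ (b - 1))"
      using assms(5,6) by blast+
    ultimately show ?thesis by linarith
  qed
qed

lemma pderiv_map_mult:
  fixes d :: "'b::comm_ring_1 \<Rightarrow> 'b"
  assumes add: "\<And>x y. d (x + y) = d x + d y" and mult: "\<And>x y. d (x * y) = x * d y + d x * y"
  shows "map_poly d (p + q) = map_poly d p + map_poly d q"
    "map_poly d (p * q) = p * map_poly d q + map_poly d p * q"
proof -
  have 0: "d 0 = 0" using add[of 0 0] by simp
  show add': "map_poly d (p + q) = map_poly d p + map_poly d q" for p q
    by (rule poly_eqI) (simp add: coeff_map_poly 0 add)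
  have smult: "map_poly d (smult c q) = smult c (map_poly d q) + smult (d c) q" for c q
    by (rule poly_eqI) (simp add: coeff_map_poly 0 mult)
  show "map_poly d (p * q) = p * map_poly d q + map_poly d p * q"
  proof (induction p)
    case 0
    show ?case by simp
  next
    case (pCons c p)
    then show ?case by (simp add: add' smult map_poly_pCons 0 algebra_simps)
  qed
qed

lemma derivation_power:
  fixes d :: "'b::comm_ring_1 \<Rightarrow> 'b"
  assumes "\<And>x y. d (x * y) = x * d y + d x * y"
  shows "d (x ^ Suc n) = of_nat (Suc n) * x ^ n * d x"
  by (induction n) (simp_all add: assms[of x] algebra_simps)

text \<open>Applied to coefficients only, the derivation kills \<open>X ^ a\<close> because
  \<open>a\<close> is 0 in the ring. The nonzero constant \<open>d h\<close> is therefore a multiple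
  of \<open>Y ^ (b - 1)\<close>, so \<open>Y\<close> is constant, and the relation makes
  \<open>X\<close> constant too.\<close>

lemma power_sum_const_inseparable:
  fixes X Y :: "'b::idom poly" and d :: "'b \<Rightarrow> 'b"
  assumes eq: "[:c:] * X ^ a + [:e:] * Y ^ b = [:h:]" and "c \<noteq> 0" "e \<noteq> 0" "a \<ge> 1" "b \<ge> 2"
    and a: "of_nat a = (0::'b)" and d: "\<And>x y. d (x + y) = d x + d y" "\<And>x y. d (x * y) = x * d y + d x * y"
    and "d c = 0" "d e = 0" "d h \<noteq> 0"
  shows "degree X = 0 \<and> degree Y = 0"
proof -
  let ?D = "map_poly d"
  note D = pderiv_map_mult[of d, OF d]
  have 0: "d 0 = 0" using d(1)[of 0 0] by (metis add.right_neutral add_left_cancel)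
  have const: "?D [:x:] = [:d x:]" for x by (simp add: map_poly_pCons 0)
  obtain a' b' where a': "a = Suc a'" and b': "b = Suc b'" "b' \<ge> 1"
    using assms by (cases a; cases b) auto
  have "?D (X ^ a) = of_nat a * X ^ a' * ?D X" unfolding a' by (rule derivation_power[OF D(2)])
  also have "of_nat a = (0 :: 'b poly)" unfolding of_nat_poly a by simp
  finally have X: "?D (X ^ a) = 0" by simp
  have Y: "?D (Y ^ b) = of_nat b * Y ^ b' * ?D Y" unfolding b' by (rule derivation_power[OF D(2)])
  have "[:d h:] = ?D ([:c:] * X ^ a + [:e:] * Y ^ b)" unfolding eq const ..
  also have "\<dots> = Y ^ b' * ([:e:] * of_nat b * ?D Y)"
    unfolding D X Y const by (simp add: assms algebra_simps)
  finally have dv: "[:d h:] = Y ^ b' * ([:e:] * of_nat b * ?D Y)" .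
  then have "Y ^ b' dvd [:d h:]" by (rule dvdI)
  then have "degree (Y ^ b') \<le> degree [:d h:]"
    using \<open>d h \<noteq> 0\<close> by (intro dvd_imp_degree_le) simp_all
  moreover have "Y \<noteq> 0" using dv \<open>d h \<noteq> 0\<close> b'(2) by auto
  ultimately have Y0: "degree Y = 0" using b'(2) by (simp add: degree_power_eq)
  then obtain y where "Y = [:y:]" by (meson degree_eq_zeroE)
  moreover have "[:c:] * X ^ a = [:h:] - [:e:] * Y ^ b" using eq by (simp only: eq_diff_eq)
  ultimately have "[:c:] * X ^ a = [:h - e * y ^ b:]" by (simp add: poly_const_pow)
  then have "degree ([:c:] * X ^ a) = 0" by simp
  then have "degree (X ^ a) = 0" using \<open>c \<noteq> 0\<close> by simp
  then have "degree X = 0" using degree_power_eq[of X a] \<open>a \<ge> 1\<close> by (cases "X = 0") simp_all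
  with Y0 show ?thesis by simp
qed

section \<open>Degree reduction of plane automorphisms\<close>

text \<open>Coprime \<open>a\<close> and \<open>b\<close> cannot both vanish in the field. If
  \<open>a\<close> does, the coefficients are differentiated by \<open>y\<close>, if
  \<open>b\<close> does, by \<open>x\<close>, and each time the binomial has a nonzero derivative.
  Otherwise the separable case applies.\<close>

lemma binomial_const_imp_const:
  fixes X Y :: "'a::field poly2 poly"
  assumes eq: "X ^ a - [:[:[:c:]:]:] * Y ^ b = [:poly2_x ^ a - [:[:c:]:] * poly2_y ^ b:]"
    and "c \<noteq> 0" "a \<ge> 2" "b \<ge> 2" "coprime a b"
  shows "degree X = 0 \<and> degree Y = 0"
proof -
  let ?c = "[:[:c:]:] :: 'a poly2"
  define h where "h = poly2_x ^ a - ?c * poly2_y ^ b"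
  have h: "coeff (coeff h k) l = (if k = 0 \<and> l = a then 1 else 0) - (if k = b \<and> l = 0 then c else 0)" for k l
    using coeff_monom_xy[of 1 a 0 k l] coeff_monom_xy[of c 0 b k l]
    by (simp add: h_def flip: one_pCons)
  have "h \<noteq> 0" using h[of b 0] assms by auto
  have eq1: "[:1:] * X ^ a + [:- ?c:] * Y ^ b = [:h:]"
  proof -
    have "[:- C:] * Z = - ([:C:] * Z)" for C :: "'a poly2" and Z by simp
    then have "[:1:] * X ^ a + [:- ?c:] * Y ^ b = X ^ a - [:?c:] * Y ^ b"
      by (simp only: one_pCons[symmetric] mult_1 add_uminus_conv_diff)
    then show ?thesis using eq by (simp only: h_def)
  qed
  then have eq2: "[:- ?c:] * Y ^ b + [:1:] * X ^ a = [:h:]" by (simp add: add.commute)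
  have of_nat: "of_nat k = (0 :: 'a poly2) \<longleftrightarrow> of_nat k = (0 :: 'a)" for k
    by (simp add: of_nat_poly)
  have "\<not> (of_nat a = (0::'a) \<and> of_nat b = (0::'a))"
    using coprime_common_divisor[OF \<open>coprime a b\<close>, of "CHAR('a)"] of_nat_CHAR[where 'a = 'a]
    unfolding of_nat_eq_0_iff_char_dvd by auto
  then consider "of_nat a = (0::'a)" "of_nat b \<noteq> (0::'a)" | "of_nat b = (0::'a)" "of_nat a \<noteq> (0::'a)"
    | "of_nat a \<noteq> (0::'a)" "of_nat b \<noteq> (0::'a)" by blast
  then show ?thesis
  proof cases
    case 1
    obtain b' where b': "b = Suc b'" using assms by (cases b) auto
    have "coeff (coeff (pderiv h) b') 0 = - of_nat b * c"
      using assms unfolding coeff_pderiv b'[symmetric]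
      by (simp add: of_nat_poly h[of b 0] mult_of_nat_commute)
    then have "pderiv h \<noteq> 0" using 1 assms by auto
    then show ?thesis
      using 1 assms
      by (intro power_sum_const_inseparable[OF eq1, where d = pderiv])
         (auto simp: of_nat pderiv_add pderiv_mult pderiv_pCons pderiv_minus)
  next
    case 2
    let ?d = "map_poly pderiv :: 'a poly2 \<Rightarrow> 'a poly2"
    obtain a' where a': "a = Suc a'" using assms by (cases a) auto
    have "coeff (coeff (?d h) 0) a' = of_nat a"
      using assms by (simp add: coeff_map_poly coeff_pderiv h a')
    then have "?d h \<noteq> 0" using 2 by auto
    then have "degree Y = 0 \<and> degree X = 0"
      using 2 assms
      by (intro power_sum_const_inseparable[OF eq2, where d = ?d])
         (auto simp: of_nat pderiv_x_rules map_poly_pCons pderiv_pCons pderiv_minus map_poly_1)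
    then show ?thesis by simp
  next
    case 3
    then show ?thesis
      using assms \<open>h \<noteq> 0\<close> by (intro power_sum_const_separable[OF eq1]) (auto simp: of_nat)
  qed
qed

text \<open>The weights 0 and 1 measure the \<open>y\<close>-degree, with all of \<open>K[x]\<close>
  in weight 0.\<close>

lemma lead2_top_y: "lead2 0 1 (real (degree F)) F (monom (lead_coeff F) (degree F))"
  unfolding lead2_def lead_poly_def lead_const_def
  by (auto simp: coeff_eq_0)

text \<open>With positive weights only the constant term has weight at most 0.\<close>

lemma lead2_nonneg:
  assumes "lead2 wx wy D P P'" "P' \<noteq> 0" "wx > 0" "wy > 0"
  shows "D > 0 \<or> (\<exists>p. P = [:[:p:]:])"
proof (rule disjCI)
  assume nc: "\<not> (\<exists>p. P = [:[:p:]:])"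
  show "D > 0"
  proof (rule ccontr)
    assume "\<not> D > 0"
    define p where "p = coeff (coeff P 0) 0"
    have "coeff (coeff P k) j = (if k = 0 \<and> j = 0 then p else 0)" for k j
    proof -
      have "D - wy * real k - wx * real j < 0" if "k > 0 \<or> j > 0"
      proof -
        have "wy * real k \<ge> 0" "wx * real j \<ge> 0" using assms by simp_all
        moreover have "wy * real k > 0 \<or> wx * real j > 0" using assms that by auto
        ultimately show ?thesis using \<open>\<not> D > 0\<close> by linarith
      qed
      then show ?thesis
        using assms(1) unfolding lead2_def lead_poly_def lead_const_def p_def by auto
    qed
    then have "P = [:[:p:]:]"
      by (intro poly_eqI) (auto simp: coeff_pCons split: nat.splits)
    then show False using nc by blast
  qed
qed

context graded
begin

text \<open>The weight \<open>\<sigma>\<close> of the variable is as small as it can be for \<open>X\<close> and \<open>Y\<close> to have the same weight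
  as their constant terms; then at least one of the leading forms involves the variable.\<close>

lemma lead_poly_nonconst:
  assumes X: "L wx (coeff X 0) x" and Y: "L wy (coeff Y 0) y" and nc: "degree X \<noteq> 0 \<or> degree Y \<noteq> 0"
  shows "\<exists>\<sigma> X' Y'. lead_poly \<sigma> L wx X X' \<and> lead_poly \<sigma> L wy Y Y' \<and> (degree X' \<noteq> 0 \<or> degree Y' \<noteq> 0)"
proof -
  obtain N H where NH: "\<And>f. f \<noteq> 0 \<Longrightarrow> H f \<noteq> 0 \<and> L (N f) f (H f)" using exists by metis
  define I where "I = (\<lambda>Z :: 'r poly. {i. i > 0 \<and> coeff Z i \<noteq> 0})"
  have fin: "finite (I Z)" for Z
    unfolding I_def using MOST_coeff_eq_0[of Z] by (simp add: eventually_cofinite)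
  have ne: "I Z \<noteq> {}" if "degree Z \<noteq> 0" for Z
    unfolding I_def using that by (metis (mono_tags, lifting) degree_0 empty_iff gr0I leading_coeff_0_iff mem_Collect_eq)
  \<comment> \<open>The term of index \<open>i\<close> respects the bound \<open>w\<close> exactly
    when \<open>\<sigma>\<close> is at most this quotient, with equality when the term survives in
    the leading form. The minimum thus admits all terms and keeps one of positive index.\<close>
  define R where "R = (\<lambda>w Z. (\<lambda>i. (w - N (coeff Z i)) / real i) ` I Z)"
  define \<sigma> where "\<sigma> = Min (R wx X \<union> R wy Y)"
  have finR: "finite (R wx X \<union> R wy Y)" unfolding R_def using fin by auto
  have "R wx X \<union> R wy Y \<noteq> {}" unfolding R_def using nc ne by auto
  then have mem: "\<sigma> \<in> R wx X \<union> R wy Y" unfolding \<sigma>_def using finR by (intro Min_in)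
  have ex: "\<exists>Z'. lead_poly \<sigma> L w Z Z'"
    if Z: "L w (coeff Z 0) z" and le: "\<And>r. r \<in> R w Z \<Longrightarrow> \<sigma> \<le> r" for w Z z
  proof (rule lead_poly_exI)
    fix i
    consider "i = 0" | "coeff Z i = 0" | "i \<in> I Z" unfolding I_def by auto
    then show "\<exists>h. L (w - \<sigma> * real i) (coeff Z i) h"
    proof cases
      case 3
      then have i: "i > 0" "coeff Z i \<noteq> 0" by (auto simp: I_def)
      have "\<sigma> \<le> (w - N (coeff Z i)) / real i" using 3 by (intro le) (auto simp: R_def)
      then have "N (coeff Z i) \<le> w - \<sigma> * real i" using i by (simp add: field_simps)
      then consider "N (coeff Z i) = w - \<sigma> * real i" | "N (coeff Z i) < w - \<sigma> * real i" by linarith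
      then show ?thesis using NH[OF i(2)] strict by cases metis+
    qed (use Z zero in auto)
  qed
  have nonconst: "degree Z' \<noteq> 0" if lead: "lead_poly \<sigma> L w Z Z'" and mem: "\<sigma> \<in> R w Z" for w Z Z'
  proof -
    obtain i where i: "i > 0" "coeff Z i \<noteq> 0" "\<sigma> = (w - N (coeff Z i)) / real i"
      using mem by (auto simp: R_def I_def)
    then have "w - \<sigma> * real i = N (coeff Z i)" by (simp add: field_simps)
    then have "L (N (coeff Z i)) (coeff Z i) (coeff Z' i)" using lead unfolding lead_poly_def by metis
    then have "coeff Z' i \<noteq> 0" using NH[OF i(2)] unique by metis
    then show ?thesis using i(1) le_degree by fastforce
  qed
  obtain X' where X': "lead_poly \<sigma> L wx X X'" using ex[OF X] finR unfolding \<sigma>_def by auto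
  obtain Y' where Y': "lead_poly \<sigma> L wy Y Y'" using ex[OF Y] finR unfolding \<sigma>_def by auto
  show ?thesis using X' Y' nonconst mem by blast
qed

end

lemma degree_cancel_less:
  fixes p q :: "'b::comm_ring_1 poly"
  assumes "degree p = n" "degree q = n" "lead_coeff p = lead_coeff q" "n > 0"
  shows "degree (p - q) < n"
proof -
  have "degree (p - q) \<le> n" using degree_diff_le_max[of p q] assms by simp
  moreover have "coeff (p - q) n = 0" using assms by simp
  ultimately show ?thesis using assms(4) eq_zero_or_degree_less by fastforce
qed

lemma lead_coeff_const2_mult:
  fixes G :: "'a::field poly2"
  assumes "c \<noteq> 0" "G \<noteq> 0"
  shows "degree ([:[:c:]:] * G ^ b) = b * degree G" "lead_coeff ([:[:c:]:] * G ^ b) = smult c (lead_coeff G ^ b)"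
proof -
  show "degree ([:[:c:]:] * G ^ b) = b * degree G" using assms by (simp add: degree_power_eq)
  then show "lead_coeff ([:[:c:]:] * G ^ b) = smult c (lead_coeff G ^ b)"
    using coeff_power_degree_le(2)[of G "degree G" b] by simp
qed

text \<open>The bounds on the exponents are those of the maps in the two free factors, where
  \<open>x\<close> changes by multiples of \<open>y ^ 2\<close> and \<open>y\<close> by multiples of
  \<open>x\<close>. When the two degrees agree, \<open>G\<close> is the one reduced, with exponent
  1.\<close>

theorem automorphism_degree_reduction:
  fixes F G P Q :: "'a::field poly2"
  assumes inv1: "poly2_comp (P, Q) (F, G) = (poly2_x, poly2_y)"
    and inv2: "poly2_comp (F, G) (P, Q) = (poly2_x, poly2_y)"
    and deg: "degree F > 0" "degree G > 0"
  shows "\<exists>c. (\<exists>b\<ge>2. degree (F - [:[:c:]:] * G ^ b) < degree F) \<or>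
    (\<exists>a\<ge>1. degree (G - [:[:c:]:] * F ^ a) < degree G)"
proof -
  define wx wy where "wx = real (degree F)" and "wy = real (degree G)"
  have w: "wx > 0" "wy > 0" using deg by (simp_all add: wx_def wy_def)
  define g where "g = gcd (degree F) (degree G)"
  \<comment> \<open>The quotients are crossed so that \<open>x ^ a\<close> and \<open>y ^ b\<close>
    have the same weight: \<open>a * wx = b * wy\<close>.\<close>
  define a b where "a = degree G div g" and "b = degree F div g"
  have "g > 0" using deg by (simp add: g_def)
  have dF: "degree F = b * g" and dG: "degree G = a * g" by (simp_all add: a_def b_def g_def)
  have "coprime a b"
    using div_gcd_coprime[of "degree G" "degree F"] deg unfolding a_def b_def g_def
    by (metis gcd.commute neq0_conv)
  moreover have "a > 0" using deg(2) unfolding dG by (rule contrapos_pp) simp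
  moreover have "b > 0" using deg(1) unfolding dF by (rule contrapos_pp) simp
  ultimately have ab: "coprime a b" "a > 0" "b > 0" .
  let ?k = "\<lambda>c. [:[:c:]:] :: 'a poly2" and ?\<theta> = "\<lambda>c. [:[:[:c:]:]:] :: 'a poly2 poly"
  have \<theta>: "ring_map ?\<theta>" by (intro ring_map_comp[OF ring_map_const] ring_map_const2)
  interpret A: graded "lead2 wx wy :: real \<Rightarrow> 'a poly2 \<Rightarrow> 'a poly2 \<Rightarrow> bool" by (rule graded_lead2)
  interpret T: graded "lead2 0 1 :: real \<Rightarrow> 'a poly2 \<Rightarrow> 'a poly2 \<Rightarrow> bool" by (rule graded_lead2)
  have PFG: "eval2 ?k P F G = poly2_x" and QFG: "poly2_subst Q (F, G) = poly2_y"
    and FPQ: "eval2 ?k F P Q = poly2_x" "eval2 ?k G P Q = poly2_y"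
    using inv1 inv2 by (simp_all add: poly2_comp_def poly2_subst_eval2)
  have xnc: "poly2_x \<noteq> ?k p" for p by (simp add: poly2_x_def)
  have "P \<noteq> 0" using PFG xnc[of 0] by (auto simp: eval2_def)
  then obtain D P' where P': "P' \<noteq> 0" "lead2 wx wy D P P'" using A.exists by blast
  have "D > 0"
    using lead2_nonneg[OF P'(2,1) w] PFG xnc eval2_gens(1)[OF ring_map_const2] by metis

  define f0 g0 where "f0 = lead_coeff F" and "g0 = lead_coeff G"
  have FG0: "F \<noteq> 0" "G \<noteq> 0" using deg by auto
  then have fg0: "f0 \<noteq> 0" "g0 \<noteq> 0" by (simp_all add: f0_def g0_def)
  \<comment> \<open>Since \<open>P (F, G) = x\<close> has \<open>y\<close>-degree 0, below
    \<open>D\<close>, the top terms must cancel. Setting \<open>y = 1\<close> then leaves a relation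
    between the leading coefficients \<open>f0\<close> and \<open>g0\<close> in
    \<open>K[x]\<close>.\<close>
  have "lead2 0 1 D (eval2 ?k P F G) (eval2 ?k P' (monom f0 (degree F)) (monom g0 (degree G)))"
    unfolding f0_def g0_def
    by (rule T.lead2_eval2[OF ring_map_const2 _ lead2_top_y lead2_top_y P'(2)[unfolded wx_def wy_def]])
       (rule lead2_gens)
  moreover have "lead2 0 1 D poly2_x (0 :: 'a poly2)"
    using T.strict[OF lead2_gens(2)[of 0 1] \<open>D > 0\<close>] .
  ultimately have "eval2 ?k P' (monom f0 (degree F)) (monom g0 (degree G)) = 0"
    using T.unique unfolding PFG by blast
  then have "poly (eval2 ?k P' (monom f0 (degree F)) (monom g0 (degree G))) 1 = 0" by simp
  then have P0: "eval2 (\<lambda>c. [:c:]) P' f0 g0 = 0"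
    by (simp add: eval2_ring_map[OF ring_map_const2 ring_map_poly] poly_monom)

  have hom: "real j * real b + real k * real a = D / real g" if "coeff (coeff P' k) j \<noteq> 0" for j k
    using lead2_coeffD[OF P'(2) that] \<open>g > 0\<close> unfolding wx_def wy_def dF dG by (simp add: field_simps)
  obtain i j n f where f: "degree f = n" "coeff f 0 \<noteq> 0"
      "P' = poly2_x ^ i * poly2_y ^ j * homog ?k n f (poly2_x ^ a) (poly2_y ^ b)"
    using quasihomogeneous_form[OF P'(1) ab hom] by metis
  have eval_P': "eval2 \<theta> P' u v = u ^ i * v ^ j * homog \<theta> n f (u ^ a) (v ^ b)"
    if "ring_map \<theta>" for \<theta> :: "'a \<Rightarrow> 'c::comm_ring_1" and u v
    unfolding f(3)
    by (simp add: ring_mapD[OF ring_map_eval2[OF that]] homog_ring_map[OF ring_map_eval2[OF that]] eval2_gens that)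
  have "homog (\<lambda>c. [:c:]) n f (f0 ^ a) (g0 ^ b) = 0"
    using P0 fg0 unfolding f(3)
    by (simp add: ring_mapD[OF ring_map_eval2[OF ring_map_const]]
        homog_ring_map[OF ring_map_eval2[OF ring_map_const]] eval2_gens ring_map_const)
  then obtain c where c: "poly f c = 0" "c \<noteq> 0" "f0 ^ a = smult c (g0 ^ b)"
    using homog_eq_0[OF _ f(1,2)] fg0 by (metis power_eq_0_iff)
  then obtain f1 where f1: "f = [:- c, 1:] * f1" unfolding poly_eq_0_iff_dvd by (auto elim: dvdE)
  have "f1 \<noteq> 0" using f(2) unfolding f1 by auto
  then have n: "n = Suc (degree f1)"
    using f(1) degree_mult_eq[of "[:- c, 1:]" f1] unfolding f1 by simp

  \<comment> \<open>With \<open>s\<close> the outermost variable, \<open>[:Q, 1:]\<close> is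
    \<open>Q + s\<close>. The pair is \<open>(x, y)\<close> at \<open>s = 0\<close>, and it involves
    \<open>s\<close> because \<open>Q (X, Y) = Q + s\<close>.\<close>
  define X Y where "X = eval2 ?\<theta> F [:P:] [:Q, 1:]" and "Y = eval2 ?\<theta> G [:P:] [:Q, 1:]"
  have PXY: "eval2 ?\<theta> P X Y = [:P:]" and QXY: "eval2 ?\<theta> Q X Y = [:Q, 1:]"
    unfolding X_def Y_def
    using eval2_subst[OF \<theta>, of P "(F, G)" "[:P:]" "[:Q, 1:]"]
      eval2_subst[OF \<theta>, of Q "(F, G)" "[:P:]" "[:Q, 1:]"] PFG QFG
    by (simp_all add: poly2_subst_eval2 eval2_gens[OF \<theta>])
  have "poly X 0 = poly2_x" "poly Y 0 = poly2_y"
    unfolding X_def Y_def using FPQ by (simp_all add: eval2_ring_map[OF \<theta> ring_map_poly])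
  then have XY0: "coeff X 0 = poly2_x" "coeff Y 0 = poly2_y" by (simp_all add: poly_0_coeff_0)
  have nc: "degree X \<noteq> 0 \<or> degree Y \<noteq> 0"
  proof (rule ccontr)
    assume "\<not> ?thesis"
    then obtain x y where "X = [:x:]" "Y = [:y:]" by (metis degree_eq_zeroE)
    then have "eval2 ?\<theta> Q X Y = [:eval2 ?k Q x y:]"
      by (simp add: eval2_ring_map[OF ring_map_const2 ring_map_const])
    then show False unfolding QXY by simp
  qed
  obtain \<sigma> X' Y' where XY': "lead_poly \<sigma> (lead2 wx wy) wx X X'" "lead_poly \<sigma> (lead2 wx wy) wy Y Y'"
      and nc': "degree X' \<noteq> 0 \<or> degree Y' \<noteq> 0"
    using A.lead_poly_nonconst[of wx X poly2_x wy Y poly2_y] XY0 nc lead2_gens by metis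
  have XY0': "coeff X' 0 = poly2_x" "coeff Y' 0 = poly2_y"
    using XY' XY0 lead2_gens(2,3)[of wx wy, where 'a = 'a] A.unique unfolding lead_poly_def
    by (metis diff_zero mult_zero_right of_nat_0)+
  interpret S: graded "lead_poly \<sigma> (lead2 wx wy) :: real \<Rightarrow> 'a poly2 poly \<Rightarrow> 'a poly2 poly \<Rightarrow> bool"
    by (rule A.graded_lead_poly)
  have "lead_poly \<sigma> (lead2 wx wy) D (eval2 ?\<theta> P X Y) (eval2 ?\<theta> P' X' Y')"
    by (rule S.lead2_eval2[OF \<theta> _ XY' P'(2)]) (intro lead_poly_gens(1) lead2_gens graded_lead2)
  moreover have "lead_poly \<sigma> (lead2 wx wy) D [:P:] [:P':]"
    by (intro lead_poly_gens(1) P' graded_lead2)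
  ultimately have P'XY: "eval2 ?\<theta> P' X' Y' = [:P':]" using S.unique unfolding PXY by blast
  let ?h = "X' ^ a - [:?k c:] * Y' ^ b"
  have "[:P':] = X' ^ i * Y' ^ j * (?h * homog ?\<theta> (degree f1) f1 (X' ^ a) (Y' ^ b))"
    using P'XY unfolding eval_P'[OF \<theta>] unfolding n f1 homog_linear_factor[OF \<theta> order_refl] by simp
  \<comment> \<open>A divisor of a nonzero polynomial free of \<open>s\<close> is itself free of
    \<open>s\<close>, hence equal to its value at \<open>s = 0\<close>.\<close>
  then have "?h dvd [:P':]" by (metis dvd_mult dvd_triv_left)
  then have "degree ?h = 0" using dvd_imp_degree_le[of ?h "[:P':]"] P'(1) by simp
  then have "?h = [:coeff ?h 0:]" by (metis degree_0_id)
  also have "coeff ?h 0 = poly2_x ^ a - ?k c * poly2_y ^ b"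
    using XY0' by (simp add: coeff_0_power coeff_mult_0)
  finally have "?h = [:poly2_x ^ a - ?k c * poly2_y ^ b:]" .
  then have "\<not> (a \<ge> 2 \<and> b \<ge> 2)"
    using binomial_const_imp_const[of X' a c Y' b] c(2) ab nc' by blast
  then consider "b = 1" | "a = 1" "b \<ge> 2" using ab by linarith
  then show ?thesis
  proof cases
    case 1
    note L = lead_coeff_const2_mult[of "1 / c" F a, OF _ FG0(1)]
    have "degree (?k (1 / c) * F ^ a) = degree G" using L(1) deg c(2) dF dG 1 by auto
    moreover have "lead_coeff G = lead_coeff (?k (1 / c) * F ^ a)"
      using L(2) deg c(2,3) 1 unfolding f0_def g0_def by auto
    ultimately have "degree (G - ?k (1 / c) * F ^ a) < degree G"
      using deg by (intro degree_cancel_less) simp_all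
    then show ?thesis using ab by (metis One_nat_def Suc_leI)
  next
    case 2
    note L = lead_coeff_const2_mult[OF c(2) FG0(2), of b]
    have "degree (?k c * G ^ b) = degree F" using L(1) deg c(2) dF dG 2 by auto
    moreover have "lead_coeff F = lead_coeff (?k c * G ^ b)"
      using L(2) deg c(2,3) 2 unfolding f0_def g0_def by auto
    ultimately have "degree (F - ?k c * G ^ b) < degree F"
      using deg by (intro degree_cancel_less) simp_all
    then show ?thesis using 2 by blast
  qed
qed

section \<open>Words in a free product\<close>

text \<open>The Boolean of a letter names the free factor, the second component an element of
  it.\<close>

type_synonym 'f word = "(bool \<times> 'f) list"

fun reduced :: "'f::ab_group_add word \<Rightarrow> bool" where
  "reduced [] \<longleftrightarrow> True"
| "reduced [(b, f)] \<longleftrightarrow> f \<noteq> 0"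
| "reduced ((b, f) # (c, g) # w) \<longleftrightarrow> f \<noteq> 0 \<and> b \<noteq> c \<and> reduced ((c, g) # w)"

text \<open>Left multiplication by one letter on normal forms of the free product.\<close>

fun reduced_Cons :: "bool \<times> 'f \<Rightarrow> 'f::ab_group_add word \<Rightarrow> 'f word" where
  "reduced_Cons (b, f) [] = (if f = 0 then [] else [(b, f)])"
| "reduced_Cons (b, f) ((c, g) # w) =
    (if f = 0 then (c, g) # w
     else if b = c then (if f + g = 0 then w else (b, f + g) # w)
     else (b, f) # (c, g) # w)"

lemma reduced_ConsD: "reduced (l # w) \<Longrightarrow> reduced w"
  by (cases l; cases w) auto

lemma reduced_reduced_Cons: "reduced w \<Longrightarrow> reduced (reduced_Cons l w)"
proof (cases l; cases w)
  fix b f l' w' assume l: "l = (b, f)" and w: "w = l' # w'" "reduced w"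
  obtain c g where l': "l' = (c, g)" by fastforce
  show ?thesis
    using w reduced_ConsD[of l' w'] unfolding l w l' by (cases w') auto
qed auto

definition inv_word :: "'f::ab_group_add word \<Rightarrow> 'f word" where
  "inv_word w = rev (map (\<lambda>(b, f). (b, - f)) w)"

definition reduce :: "'f::ab_group_add word \<Rightarrow> 'f word" where
  "reduce w = foldr reduced_Cons w []"

lemma reduced_reduce: "reduced (reduce w)"
  unfolding reduce_def by (induction w) (simp_all add: reduced_reduced_Cons)

text \<open>An action of the free product of two copies of \<open>'f\<close> for which the orbit map at \<open>u\<close> is injective.\<close>

locale letter_action =
  fixes act :: "bool \<times> 'f::ab_group_add \<Rightarrow> 'm \<Rightarrow> 'm" and u :: 'm
  assumes merge: "act (b, f) (act (b, g) z) = act (b, f + g) z"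
    and zero: "act (b, 0) z = z"
    and faithful: "reduced w \<Longrightarrow> w \<noteq> [] \<Longrightarrow> foldr act w u \<noteq> u"
begin

lemma act_reduced_Cons: "foldr act (reduced_Cons l w) z = act l (foldr act w z)"
proof (cases l; cases w)
  fix b f l' w' assume l: "l = (b, f)" and w: "w = l' # w'"
  obtain c g where l': "l' = (c, g)" by fastforce
  show ?thesis unfolding l w l' by (simp add: merge zero)
qed (simp_all add: zero)

lemma act_reduce: "foldr act (reduce w) z = foldr act w z"
  unfolding reduce_def by (induction w) (simp_all add: act_reduced_Cons)

lemma act_inverse: "act (b, - f) (act (b, f) z) = z" "act (b, f) (act (b, - f) z) = z"
  by (simp_all add: merge zero)

lemma act_inv_word: "foldr act (inv_word w) (foldr act w z) = z"
  unfolding inv_word_def by (induction w arbitrary: z) (auto simp: act_inverse)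

lemma act_inv_word': "foldr act w (foldr act (inv_word w) z) = z"
  unfolding inv_word_def by (induction w arbitrary: z) (auto simp: act_inverse)

text \<open>The right side does not mention the action, so any two such actions identify the same
  words.\<close>

lemma act_eq_iff: "foldr act w u = foldr act w' u \<longleftrightarrow> reduce (inv_word w' @ w) = []"
proof -
  have "foldr act w u = foldr act w' u \<longleftrightarrow> foldr act (inv_word w' @ w) u = u"
    by (metis act_inv_word act_inv_word' foldr_append)
  also have "\<dots> \<longleftrightarrow> foldr act (reduce (inv_word w' @ w)) u = u" by (simp only: act_reduce)
  also have "\<dots> \<longleftrightarrow> reduce (inv_word w' @ w) = []"
    using faithful[OF reduced_reduce] by auto
  finally show ?thesis .
qed

end

text \<open>Each element of \<open>G\<close> is written as a word, which is then read in
  \<open>H\<close>. As both actions identify the same words, the chosen words do not affect the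
  result, and the map is an injective homomorphism.\<close>

lemma group_embedsI:
  fixes act1 :: "bool \<times> 'f::ab_group_add \<Rightarrow> 'm \<Rightarrow> 'm" and act2 :: "bool \<times> 'f \<Rightarrow> 'n \<Rightarrow> 'n"
  assumes 1: "letter_action act1 u1" and 2: "letter_action act2 u2"
    and mult1: "\<And>w w'. mult G (foldr act1 w u1) (foldr act1 w' u1) = foldr act1 (w @ w') u1"
    and mult2: "\<And>w w'. mult H (foldr act2 w u2) (foldr act2 w' u2) = foldr act2 (w @ w') u2"
    and closed: "\<And>w. foldr act2 w u2 \<in> carrier H"
    and gen: "\<And>x. x \<in> carrier G \<Longrightarrow> \<exists>w. foldr act1 w u1 = x"
    and G: "group G"
  shows "group_embeds G H"
proof -
  have iff: "foldr act1 w u1 = foldr act1 w' u1 \<longleftrightarrow> foldr act2 w u2 = foldr act2 w' u2" for w w'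
    using letter_action.act_eq_iff[OF 1] letter_action.act_eq_iff[OF 2] by simp
  obtain W where W: "\<And>x. x \<in> carrier G \<Longrightarrow> foldr act1 (W x) u1 = x" using gen by metis
  define h where "h x = foldr act2 (W x) u2" for x
  have "h \<in> hom G H"
  proof (rule homI)
    fix x y assume xy: "x \<in> carrier G" "y \<in> carrier G"
    then have "mult G x y \<in> carrier G" using G by (meson group.is_monoid monoid.m_closed)
    then have "foldr act1 (W (mult G x y)) u1 = foldr act1 (W x @ W y) u1"
      using W xy mult1[of "W x" "W y"] by simp
    then show "h (mult G x y) = mult H (h x) (h y)"
      unfolding h_def mult2 iff .
  qed (simp add: h_def closed)
  moreover have "inj_on h (carrier G)"
    unfolding h_def inj_on_def using W iff by metis
  ultimately show ?thesis unfolding group_embeds_def mon_def by blast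
qed

section \<open>The action of triangular maps and its faithfulness\<close>

text \<open>Composition on the left with \<open>(x, y + x f(x))\<close> or
  \<open>(x + y^2 g(y), y)\<close>, for pairs over any ring so that specialisations can be compared.
  The factors \<open>x\<close> and \<open>y^2\<close> keep the origin fixed and the linear part in
  \<open>U(K)\<close>.\<close>

definition pair_act :: "('a::field \<Rightarrow> 'b::comm_ring_1) \<Rightarrow> bool \<times> 'a poly \<Rightarrow> 'b \<times> 'b \<Rightarrow> 'b \<times> 'b" where
  "pair_act \<theta> l z = (if fst l
     then (fst z, snd z + poly (map_poly \<theta> (pCons 0 (snd l))) (fst z))
     else (fst z + poly (map_poly \<theta> (pCons 0 (pCons 0 (snd l)))) (snd z), snd z))"

lemma poly_map_poly_ring_map:
  assumes "ring_map \<theta>" "ring_map \<eta>"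
  shows "\<eta> (poly (map_poly \<theta> p) z) = poly (map_poly (\<lambda>c. \<eta> (\<theta> c)) p) (\<eta> z)"
  using ring_mapD[OF assms(1)] ring_mapD[OF assms(2)]
  by (induction p) (simp_all add: map_poly_pCons)

lemma pair_act_ring_map:
  assumes "ring_map \<theta>" "ring_map \<eta>"
  shows "map_prod \<eta> \<eta> (pair_act \<theta> l z) = pair_act (\<lambda>c. \<eta> (\<theta> c)) l (map_prod \<eta> \<eta> z)"
  unfolding pair_act_def
  by (simp add: ring_mapD[OF assms(2)] poly_map_poly_ring_map[OF assms] del: map_poly_pCons)

lemma foldr_pair_act_ring_map:
  assumes "ring_map \<theta>" "ring_map \<eta>"
  shows "map_prod \<eta> \<eta> (foldr (pair_act \<theta>) w z) = foldr (pair_act (\<lambda>c. \<eta> (\<theta> c))) w (map_prod \<eta> \<eta> z)"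
  by (induction w) (simp_all add: pair_act_ring_map[OF assms])

lemma pair_act_merge:
  assumes "ring_map \<theta>"
  shows "pair_act \<theta> (b, f) (pair_act \<theta> (b, g) z) = pair_act \<theta> (b, f + g) z"
    "pair_act \<theta> (b, 0) z = z"
  unfolding pair_act_def using ring_mapD[OF assms] ring_mapD(2)[OF ring_map_eval_map_poly[OF assms]]
  by (auto simp: map_poly_pCons algebra_simps)

text \<open>Ping-pong domains in terms of degrees: a nonzero letter of factor \<open>b\<close>
  raises the degree sum of such a pair and makes it ready for the other factor. Equal degrees are
  allowed for \<open>False\<close> because its letters carry the factor \<open>y^2\<close>.\<close>

definition ready :: "bool \<Rightarrow> 'a::field poly \<times> 'a poly \<Rightarrow> bool" where
  "ready b z \<longleftrightarrow> (if b then degree (snd z) < degree (fst z) \<and> 0 < degree (snd z)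
     else degree (fst z) \<le> degree (snd z) \<and> 0 < degree (fst z))"

lemma ready_pair_act:
  fixes z :: "'a::field poly \<times> 'a poly"
  assumes "ready b z" "f \<noteq> 0"
  defines "z' \<equiv> pair_act (\<lambda>c. [:c:]) (b, f) z"
  shows "ready (\<not> b) z' \<and> degree (fst z) + degree (snd z) < degree (fst z') + degree (snd z')"
proof (cases b)
  case True
  define s where "s = pcompose (pCons 0 f) (fst z)"
  have z': "z' = (fst z, snd z + s)"
    by (simp only: z'_def pair_act_def True s_def pcompose_altdef fst_conv snd_conv if_True)
  have "degree s = (1 + degree f) * degree (fst z)"
    using assms(2) by (simp add: s_def degree_pcompose)
  then have "degree s \<ge> degree (fst z)" by simp
  moreover from this have "degree (snd z + s) = degree s"
    using assms(1) True by (intro degree_add_eq_right) (simp add: ready_def)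
  ultimately show ?thesis using assms(1) True unfolding z' ready_def by auto
next
  case False
  define s where "s = pcompose (pCons 0 (pCons 0 f)) (snd z)"
  have z': "z' = (fst z + s, snd z)"
    by (simp only: z'_def pair_act_def False s_def pcompose_altdef fst_conv snd_conv if_False)
  have "degree s = (2 + degree f) * degree (snd z)"
    using assms(2) by (simp add: s_def degree_pcompose)
  then have "degree s > degree (snd z)" using assms(1) False by (simp add: ready_def)
  moreover from this have "degree (fst z + s) = degree s"
    using assms(1) False by (intro degree_add_eq_right) (simp add: ready_def)
  ultimately show ?thesis using assms(1) False unfolding z' ready_def by auto
qed

lemma degree_foldr_pair_act:
  fixes z :: "'a::field poly \<times> 'a poly"
  assumes "reduced w" "w \<noteq> []" "ready (fst (last w)) z"
  defines "Z \<equiv> foldr (pair_act (\<lambda>c. [:c:])) w z"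
  shows "ready (\<not> fst (hd w)) Z \<and> degree (fst z) + degree (snd z) < degree (fst Z) + degree (snd Z)"
  using assms(1-3) unfolding Z_def
proof (induction w)
  case (Cons l w)
  obtain b f where l: "l = (b, f)" by fastforce
  show ?case
  proof (cases w)
    case Nil
    then show ?thesis using Cons.prems ready_pair_act[of b z f] unfolding l by simp
  next
    case (Cons l' w')
    obtain c g where l': "l' = (c, g)" by fastforce
    have "f \<noteq> 0" "b = (\<not> c)" using Cons.prems(1) unfolding l Cons l' by auto
    with Cons.IH[OF reduced_ConsD[OF Cons.prems(1)]] Cons.prems(3)
      ready_pair_act[of b "foldr (pair_act (\<lambda>c. [:c:])) w z" f]
    show ?thesis unfolding l by (simp add: Cons l')
  qed
qed simp

text \<open>A word fixing \<open>(x, y)\<close> fixes, by specialisation, every pair of polynomials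
  in one variable. This contradicts the growth of degrees at a pair that is ready for its last
  letter.\<close>

lemma letter_action_pair_act:
  "letter_action (pair_act (\<lambda>c. [:[:c:]:])) (poly2_x :: 'a::field poly2, poly2_y)"
proof
  fix w :: "'a poly word" assume w: "reduced w" "w \<noteq> []"
  show "foldr (pair_act (\<lambda>c. [:[:c:]:])) w (poly2_x, poly2_y) \<noteq> (poly2_x, poly2_y)"
  proof
    assume eq: "foldr (pair_act (\<lambda>c. [:[:c:]:])) w (poly2_x, poly2_y) = (poly2_x :: 'a poly2, poly2_y)"
    have fixp: "foldr (pair_act (\<lambda>c. [:c:])) w (p, q) = (p, q)" for p q :: "'a poly"
      using foldr_pair_act_ring_map[OF ring_map_const2 ring_map_eval2[OF ring_map_const], of p q w "(poly2_x, poly2_y)"]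
      unfolding eq by (simp add: eval2_gens ring_map_const)
    obtain z :: "'a poly \<times> 'a poly" where "ready (fst (last w)) z"
    proof (cases "fst (last w)")
      case True
      then show ?thesis by (intro that[of "(monom 1 2, monom 1 1)"]) (simp add: ready_def degree_monom_eq)
    next
      case False
      then show ?thesis by (intro that[of "(monom 1 1, monom 1 1)"]) (simp add: ready_def degree_monom_eq)
    qed
    from degree_foldr_pair_act[OF w this] fixp[of "fst z" "snd z"] show False by simp
  qed
qed (rule pair_act_merge[OF ring_map_const2])+

lemma poly2_comp_pair_act:
  "poly2_comp (pair_act (\<lambda>c. [:[:c:]:]) l \<phi>) \<psi> = pair_act (\<lambda>c. [:[:c:]:]) l (poly2_comp \<phi> \<psi>)"
proof -
  have *: "poly2_comp \<upsilon> \<psi> = map_prod (\<lambda>p. poly2_subst p \<psi>) (\<lambda>p. poly2_subst p \<psi>) \<upsilon>" for \<upsilon> :: "'a poly2 \<times> 'a poly2"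
    by (simp add: poly2_comp_def prod_eq_iff)
  show ?thesis unfolding * pair_act_ring_map[OF ring_map_const2 ring_map_subst]
    by (simp add: poly2_subst_const)
qed

lemma poly2_comp_id: "poly2_comp (poly2_x, poly2_y) \<psi> = \<psi>"
  by (simp add: poly2_comp_def)

lemma poly2_comp_foldr:
  "poly2_comp (foldr (pair_act (\<lambda>c. [:[:c:]:])) w (poly2_x, poly2_y)) \<psi> = foldr (pair_act (\<lambda>c. [:[:c:]:])) w \<psi>"
  by (induction w) (simp_all add: poly2_comp_id poly2_comp_pair_act)

section \<open>Generation by triangular automorphisms\<close>

abbreviation tri_act :: "bool \<times> 'a poly \<Rightarrow> 'a::field poly2 \<times> 'a poly2 \<Rightarrow> 'a poly2 \<times> 'a poly2" where
  "tri_act \<equiv> pair_act (\<lambda>c. [:[:c:]:])"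

abbreviation AutU :: "('a::field poly2 \<times> 'a poly2) monoid" where
  "AutU \<equiv> AutS_A2 U_lin"

lemma mult_AutS: "mult (AutS_A2 S) = poly2_comp"
  by (simp add: AutS_A2_def Aut0_A2_def Aut_A2_def End_A2_def units_of_def)

lemma poly2_eval_0: "poly2_eval p 0 0 = coeff (coeff p 0) 0"
  by (simp add: poly2_eval_def poly_0_coeff_0)

text \<open>The outer index counts \<open>y\<close> and the inner one \<open>x\<close>, so the last
  three equations leave only the coefficient of \<open>x\<close> in \<open>G\<close> free in the
  linear part.\<close>

lemma AutU_iff:
  "(F, G) \<in> carrier AutU \<longleftrightarrow>
    (\<exists>P Q. poly2_comp (P, Q) (F, G) = (poly2_x, poly2_y) \<and> poly2_comp (F, G) (P, Q) = (poly2_x, poly2_y)) \<and>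
    coeff (coeff F 0) 0 = 0 \<and> coeff (coeff G 0) 0 = 0 \<and>
    coeff (coeff F 0) 1 = 1 \<and> coeff (coeff F 1) 0 = 0 \<and> coeff (coeff G 1) 0 = 1"
proof -
  have "diff_at_0 (F, G) \<in> U_lin \<longleftrightarrow>
      coeff (coeff F 0) 1 = 1 \<and> coeff (coeff F 1) 0 = 0 \<and> coeff (coeff G 1) 0 = 1"
    unfolding U_lin_eq diff_at_0_def
    by (auto simp: vec_eq_iff forall_2 poly2_eval_0 coeff_map_poly coeff_pderiv)
  then show ?thesis
    by (auto simp: AutS_A2_def Aut0_A2_def Aut_A2_def End_A2_def units_of_def Units_def poly2_eval_0)
qed

lemma tri_act_id:
  "tri_act (True, f) (poly2_x, poly2_y) = (poly2_x, poly2_y + [:pCons 0 f:])"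
  "tri_act (False, f) (poly2_x, poly2_y) = (poly2_x + map_poly (\<lambda>c. [:c:]) (pCons 0 (pCons 0 f)), poly2_y)"
proof -
  have x: "poly (map_poly (\<lambda>c. [:[:c:]:]) p) poly2_x = [:p:]" for p :: "'a poly"
    using poly2_subst_id[of "[:p:]"] by (simp add: poly2_subst_def map_poly_pCons)
  have y: "poly (map_poly (\<lambda>c. [:[:c:]:]) p) poly2_y = map_poly (\<lambda>c. [:c:]) p" for p :: "'a poly"
    using poly2_subst_id[of "map_poly (\<lambda>c. [:c:]) p"]
    by (simp add: poly2_subst_def map_poly_map_poly o_def map_poly_pCons)
  show "tri_act (True, f) (poly2_x, poly2_y) = (poly2_x, poly2_y + [:pCons 0 f:])"
    "tri_act (False, f) (poly2_x, poly2_y) = (poly2_x + map_poly (\<lambda>c. [:c:]) (pCons 0 (pCons 0 f)), poly2_y)"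
    by (simp_all only: pair_act_def fst_conv snd_conv if_True if_False x y)
qed

text \<open>A letter acts as composition with its value at \<open>(x, y)\<close>, and this lies in
  the group, the inverse being the letter of \<open>- f\<close>.\<close>

lemma tri_act_AutU:
  fixes \<phi> :: "'a::field poly2 \<times> 'a poly2"
  assumes "\<phi> \<in> carrier AutU"
  shows "tri_act l \<phi> \<in> carrier AutU"
proof -
  interpret T: letter_action "tri_act" "(poly2_x :: 'a poly2, poly2_y)" by (rule letter_action_pair_act)
  interpret U: group "AutU :: ('a poly2 \<times> 'a poly2) monoid" by (rule group_AutU_A2)
  obtain b f where l: "l = (b, f)" by fastforce
  let ?id = "(poly2_x :: 'a poly2, poly2_y)"
  have "poly2_comp (tri_act (b, - f) ?id) (tri_act l ?id) = ?id"
    "poly2_comp (tri_act l ?id) (tri_act (b, - f) ?id) = ?id"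
    unfolding l by (simp_all add: poly2_comp_pair_act poly2_comp_id T.act_inverse)
  moreover have "coeff (coeff (fst (tri_act l ?id)) 0) 0 = 0" "coeff (coeff (snd (tri_act l ?id)) 0) 0 = 0"
    "coeff (coeff (fst (tri_act l ?id)) 0) 1 = 1" "coeff (coeff (fst (tri_act l ?id)) 1) 0 = 0"
    "coeff (coeff (snd (tri_act l ?id)) 1) 0 = 1"
    unfolding l by (cases b; simp add: tri_act_id; simp add: poly2_x_def poly2_y_def coeff_map_poly coeff_pCons)+
  ultimately have "tri_act l ?id \<in> carrier AutU"
    using AutU_iff[of "fst (tri_act l ?id)" "snd (tri_act l ?id)"] by (metis prod.collapse)
  then have "mult AutU (tri_act l ?id) \<phi> \<in> carrier AutU" using assms by (rule U.m_closed)
  then show ?thesis by (simp add: mult_AutS poly2_comp_pair_act poly2_comp_id)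
qed

lemma poly_map_poly_monom:
  assumes "ring_map \<theta>"
  shows "poly (map_poly \<theta> (monom c n)) z = \<theta> c * z ^ n"
  by (simp add: map_poly_monom ring_mapD[OF assms] poly_monom)

lemma const2_minus_mult: "[:[:- c:]:] * Z = - ([:[:c:]:] * (Z :: 'a::field poly2))"
proof -
  have "[:[:- c:]:] = - [:[:c:]:]" by simp
  then show ?thesis by (simp only: mult_minus_left)
qed

text \<open>The subtractions of the degree reduction are letters; since letters omit the factors
  \<open>y^2\<close> and \<open>x\<close>, the exponents are shifted by 2 and 1.\<close>

lemma tri_act_monom:
  "b \<ge> 2 \<Longrightarrow> tri_act (False, monom (- c) (b - 2)) (F, G) = (F - [:[:c:]:] * G ^ b, G)"
  "a \<ge> 1 \<Longrightarrow> tri_act (True, monom (- c) (a - 1)) (F, G) = (F, G - [:[:c:]:] * F ^ a)"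
proof -
  assume "b \<ge> 2"
  then obtain b' where "b = Suc (Suc b')" by (metis Suc_le_D numeral_2_eq_2 Suc_le_mono)
  then have "pCons 0 (pCons 0 (monom (- c) (b - 2))) = monom (- c) b" by (simp add: monom_Suc)
  then show "tri_act (False, monom (- c) (b - 2)) (F, G) = (F - [:[:c:]:] * G ^ b, G)"
    by (simp only: pair_act_def poly_map_poly_monom[OF ring_map_const2] const2_minus_mult
        fst_conv snd_conv if_True if_False add_uminus_conv_diff)
next
  assume "a \<ge> 1"
  then have "pCons 0 (monom (- c) (a - 1)) = monom (- c) a" by (cases a) (simp_all add: monom_Suc)
  then show "tri_act (True, monom (- c) (a - 1)) (F, G) = (F, G - [:[:c:]:] * F ^ a)"
    by (simp only: pair_act_def poly_map_poly_monom[OF ring_map_const2] const2_minus_mult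
        fst_conv snd_conv if_True if_False add_uminus_conv_diff)
qed

text \<open>The base of the induction. From \<open>F\<close> in \<open>K[x]\<close> and
  \<open>F (P) = x\<close> it follows that \<open>F\<close> has degree 1, so \<open>F = x\<close> by
  the normalisation at the origin. Then \<open>Q (x, G) = y\<close> forces \<open>G\<close> to be
  linear in \<open>y\<close> with a constant leading coefficient, which is 1.\<close>

lemma AutU_const_y:
  fixes F G :: "'a::field poly2"
  assumes FG: "(F, G) \<in> carrier AutU" and "degree F = 0"
  shows "\<exists>f. (F, G) = tri_act (True, f) (poly2_x, poly2_y)"
proof -
  obtain P Q where inv: "poly2_comp (P, Q) (F, G) = (poly2_x, poly2_y)" "poly2_comp (F, G) (P, Q) = (poly2_x, poly2_y)"
    and c: "coeff (coeff F 0) 0 = 0" "coeff (coeff G 0) 0 = 0" "coeff (coeff F 0) 1 = 1" "coeff (coeff G 1) 0 = 1"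
    using FG unfolding AutU_iff by blast
  obtain r where r: "F = [:r:]" using \<open>degree F = 0\<close> by (rule degree_eq_zeroE)
  \<comment> \<open>Setting \<open>y = 0\<close> carries \<open>F (P) = x\<close> into
    \<open>K[x]\<close>, where degrees multiply under composition.\<close>
  let ?e = "\<lambda>p. eval2 (\<lambda>c. [:c:]) p [:0, 1:] 0 :: 'a poly"
  have "poly (map_poly (\<lambda>c. [:[:c:]:]) r) P = poly2_x"
    using inv(2) unfolding r by (simp add: poly2_comp_def poly2_subst_def map_poly_pCons)
  then have "?e (poly (map_poly (\<lambda>c. [:[:c:]:]) r) P) = [:0, 1:]"
    by (simp add: eval2_gens ring_map_const)
  then have "pcompose r (?e P) = [:0, 1:]"
    by (simp add: poly_map_poly_ring_map[OF ring_map_const2 ring_map_eval2[OF ring_map_const]]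
        eval2_gens ring_map_const pcompose_altdef)
  then have "degree r * degree (?e P) = 1" using degree_pcompose[of r "?e P"] by simp
  then have "degree r = 1" by simp
  then have "r = [:0, 1:]" using c(1,3) unfolding r
    by (intro poly_eqI) (auto simp: coeff_pCons coeff_eq_0 split: nat.splits)
  then have F: "F = poly2_x" using r by (simp add: poly2_x_def)
  have x: "poly (map_poly (\<lambda>c. [:[:c:]:]) p) poly2_x = [:p:]" for p :: "'a poly"
    using poly2_subst_id[of "[:p:]"] by (simp add: poly2_subst_def map_poly_pCons)
  have QG: "pcompose Q G = poly2_y"
    using inv(1) unfolding F by (simp add: poly2_comp_def poly2_subst_def x pcompose_altdef)
  then have "degree Q * degree G = 1"
    using degree_pcompose[of Q G] by (simp add: poly2_y_def)
  then have dQG: "degree Q = 1" "degree G = 1" by simp_all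
  have lin: "p = [:coeff p 0, coeff p 1:]" if "degree p = 1" for p :: "'a poly2"
    using that by (intro poly_eqI) (auto simp: coeff_pCons coeff_eq_0 split: nat.splits)
  obtain q0 q1 g0 g1 where Q: "Q = [:q0, q1:]" and G: "G = [:g0, g1:]"
    using lin dQG by metis
  have "q1 * g1 = 1" using QG unfolding Q G poly2_y_def by (simp add: pcompose_pCons)
  then have "degree g1 = 0" using degree_mult_eq[of q1 g1] by (cases "q1 = 0"; cases "g1 = 0") auto
  then have "g1 = 1" using c(4) unfolding G by (auto elim!: degree_eq_zeroE simp: one_pCons)
  moreover have "g0 = pCons 0 (poly_shift 1 g0)"
    using c(2) unfolding G by (intro poly_eqI) (simp add: coeff_pCons coeff_poly_shift split: nat.splits)
  ultimately have "(F, G) = tri_act (True, poly_shift 1 g0) (poly2_x, poly2_y)"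
    unfolding tri_act_id F G by (simp add: poly2_y_def)
  then show ?thesis by blast
qed

text \<open>Induction on the sum of the \<open>y\<close>-degrees, which a suitable letter lowers
  while \<open>F\<close> involves \<open>y\<close>. The degree of \<open>G\<close> is always
  positive, as \<open>y\<close> has coefficient 1 in \<open>G\<close>.\<close>

theorem AutU_generated:
  fixes \<phi> :: "'a::field poly2 \<times> 'a poly2"
  assumes "\<phi> \<in> carrier AutU"
  shows "\<exists>w. foldr tri_act w (poly2_x, poly2_y) = \<phi>"
  using assms
proof (induction "degree (fst \<phi>) + degree (snd \<phi>)" arbitrary: \<phi> rule: less_induct)
  case less
  interpret T: letter_action "tri_act" "(poly2_x :: 'a poly2, poly2_y)" by (rule letter_action_pair_act)
  obtain F G where \<phi>: "\<phi> = (F, G)" by fastforce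
  have step: ?case
    if "degree (fst (tri_act (b, f) \<phi>)) + degree (snd (tri_act (b, f) \<phi>)) < degree F + degree G" for b f
  proof -
    obtain w where w: "foldr tri_act w (poly2_x, poly2_y) = tri_act (b, f) \<phi>"
      using less.hyps[OF _ tri_act_AutU[OF less.prems]] \<phi> \<open>_ < degree F + degree G\<close> by auto
    have "foldr tri_act ((b, - f) # w) (poly2_x, poly2_y) = \<phi>"
      using w by (simp add: T.act_inverse)
    then show ?thesis by blast
  qed
  have FG: "(F, G) \<in> carrier AutU" using less.prems \<phi> by simp
  then have "coeff (coeff G 1) 0 = 1" unfolding AutU_iff by blast
  then have dG: "degree G > 0" by (cases "degree G = 0") (auto simp: coeff_eq_0)
  show ?case
  proof (cases "degree F = 0")
    case True
    then obtain f where "foldr tri_act [(True, f)] (poly2_x, poly2_y) = \<phi>"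
      using AutU_const_y[OF FG] \<phi> by auto
    then show ?thesis by blast
  next
    case False
    obtain P Q where "poly2_comp (P, Q) (F, G) = (poly2_x, poly2_y)" "poly2_comp (F, G) (P, Q) = (poly2_x, poly2_y)"
      using FG unfolding AutU_iff by blast
    from automorphism_degree_reduction[OF this] False dG obtain c where
      "(\<exists>b\<ge>2. degree (F - [:[:c:]:] * G ^ b) < degree F) \<or> (\<exists>a\<ge>1. degree (G - [:[:c:]:] * F ^ a) < degree G)"
      by blast
    then show ?thesis
    proof (elim disjE exE conjE)
      fix b assume "2 \<le> b" "degree (F - [:[:c:]:] * G ^ b) < degree F"
      then show ?thesis
        using step[of False "monom (- c) (b - 2)"] unfolding \<phi> tri_act_monom(1)[OF \<open>2 \<le> b\<close>] by simp
    next
      fix a assume "1 \<le> a" "degree (G - [:[:c:]:] * F ^ a) < degree G"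
      then show ?thesis
        using step[of True "monom (- c) (a - 1)"] unfolding \<phi> tri_act_monom(2)[OF \<open>1 \<le> a\<close>] by simp
    qed
  qed
qed

section \<open>Words in shear matrices\<close>

definition shear :: "('f \<Rightarrow> 'l::field) \<Rightarrow> bool \<times> 'f \<Rightarrow> 'l^2^2" where
  "shear \<alpha> l = (if fst l then vector [vector [1, 0], vector [\<alpha> (snd l), 1]]
     else vector [vector [1, \<alpha> (snd l)], vector [0, 1]])"

lemma det_shear: "det (shear \<alpha> l) = 1"
  by (simp add: shear_def det_2)

lemma det_foldr_shear: "det (foldr (\<lambda>l M. shear \<alpha> l ** M) w (mat 1)) = 1"
  by (induction w) (simp_all add: det_shear det_mul det_I)

lemma foldr_shear_mult:
  "foldr (\<lambda>l M. shear \<alpha> l ** M) w (mat 1) ** N = foldr (\<lambda>l M. shear \<alpha> l ** M) w N"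
  by (induction w) (simp_all flip: matrix_mul_assoc)

lemma shear_add: "\<alpha> (f + g) = \<alpha> f + \<alpha> g \<Longrightarrow> shear \<alpha> (b, f) ** shear \<alpha> (b, g) = shear \<alpha> (b, f + g)"
  by (simp add: shear_def vec_eq_iff forall_2 matrix_matrix_mult_def sum_2)

lemma shear_0: "\<alpha> 0 = 0 \<Longrightarrow> shear \<alpha> (b, 0) = mat 1"
  by (simp add: shear_def vec_eq_iff forall_2 mat_def)

text \<open>The action of shears on column vectors, taken over a polynomial ring where degrees are
  available.\<close>

definition lin_act :: "('f \<Rightarrow> 'b::comm_ring_1) \<Rightarrow> bool \<times> 'f \<Rightarrow> 'b \<times> 'b \<Rightarrow> 'b \<times> 'b" where
  "lin_act \<beta> l z = (if fst l then (fst z, snd z + \<beta> (snd l) * fst z)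
     else (fst z + \<beta> (snd l) * snd z, snd z))"

text \<open>The linear counterpart of \<open>ready\<close>. Entries \<open>\<beta> f\<close> of
  positive degree make weak inequalities enough, so \<open>(1, 1)\<close> is a starting point for
  both factors.\<close>

definition ready_lin :: "bool \<Rightarrow> 'b::idom poly \<times> 'b poly \<Rightarrow> bool" where
  "ready_lin b z \<longleftrightarrow> (if b then degree (snd z) \<le> degree (fst z) \<and> fst z \<noteq> 0
     else degree (fst z) \<le> degree (snd z) \<and> snd z \<noteq> 0)"

lemma ready_lin_act:
  fixes z :: "'b::idom poly \<times> 'b poly"
  assumes "ready_lin b z" "degree (\<beta> f) > 0"
  shows "ready_lin (\<not> b) (lin_act \<beta> (b, f) z)"
    "degree (fst (lin_act \<beta> (b, f) z)) \<noteq> degree (snd (lin_act \<beta> (b, f) z))"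
proof -
  have *: "degree p < degree (q + \<beta> f * p) \<and> q + \<beta> f * p \<noteq> 0"
    if "degree q \<le> degree p" "p \<noteq> 0" for p q :: "'b poly"
  proof -
    have "degree (\<beta> f * p) = degree (\<beta> f) + degree p"
      using that assms(2) by (intro degree_mult_eq) auto
    then have "degree p < degree (\<beta> f * p)" using assms(2) by simp
    moreover from this have "degree (q + \<beta> f * p) = degree (\<beta> f * p)"
      using that(1) by (intro degree_add_eq_right) simp
    ultimately show ?thesis by auto
  qed
  show "ready_lin (\<not> b) (lin_act \<beta> (b, f) z)"
    "degree (fst (lin_act \<beta> (b, f) z)) \<noteq> degree (snd (lin_act \<beta> (b, f) z))"
    using *[of "snd z" "fst z"] *[of "fst z" "snd z"] assms(1)
    unfolding ready_lin_def lin_act_def by (cases b; auto)+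
qed

lemma degree_foldr_lin_act:
  fixes \<beta> :: "'f::ab_group_add \<Rightarrow> 'b::idom poly"
  assumes "reduced w" "w \<noteq> []" and \<beta>: "\<And>f. f \<noteq> 0 \<Longrightarrow> degree (\<beta> f) > 0"
  defines "Z \<equiv> foldr (lin_act \<beta>) w (1, 1)"
  shows "ready_lin (\<not> fst (hd w)) Z \<and> degree (fst Z) \<noteq> degree (snd Z)"
  using assms(1,2) unfolding Z_def
proof (induction w)
  case (Cons l w)
  obtain b f where l: "l = (b, f)" by fastforce
  show ?case
  proof (cases w)
    case Nil
    have "f \<noteq> 0" using Cons.prems unfolding l Nil by simp
    then show ?thesis using ready_lin_act[of b "(1, 1)" \<beta> f] \<beta>
      unfolding l Nil by (auto simp: ready_lin_def[of b])
  next
    case (Cons l' w')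
    obtain c g where l': "l' = (c, g)" by fastforce
    have "f \<noteq> 0" "b = (\<not> c)" using Cons.prems(1) unfolding l Cons l' by auto
    with Cons.IH[OF reduced_ConsD[OF Cons.prems(1)]]
      ready_lin_act[of b "foldr (lin_act \<beta>) w (1, 1)" \<beta> f] \<beta>
    show ?thesis unfolding l by (simp add: Cons l')
  qed
qed simp

lemma shear_vector:
  assumes "ring_map ev"
  shows "shear (\<lambda>f. ev (\<beta> f)) l *v vector [ev p, ev q]
    = vector [ev (fst (lin_act \<beta> l (p, q))), ev (snd (lin_act \<beta> l (p, q)))]"
  by (simp add: shear_def lin_act_def ring_mapD[OF assms] vec_eq_iff forall_2 matrix_vector_mult_def sum_2 add.commute)

lemma foldr_shear_vector:
  assumes "ring_map ev"
  shows "foldr (\<lambda>l M. shear (\<lambda>f. ev (\<beta> f)) l ** M) w (mat 1) *v vector [ev p, ev q]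
    = vector [ev (fst (foldr (lin_act \<beta>) w (p, q))), ev (snd (foldr (lin_act \<beta>) w (p, q)))]"
proof (induction w)
  case (Cons l w)
  then show ?case
    using shear_vector[OF assms, of \<beta> l "fst (foldr (lin_act \<beta>) w (p, q))" "snd (foldr (lin_act \<beta>) w (p, q))"]
    by (simp flip: matrix_vector_mul_assoc)
qed simp

text \<open>A trivial word fixes the vector \<open>(1, 1)\<close>, whereas its image over the
  polynomials has entries of different degrees. Injectivity of \<open>ev\<close> is asked on
  \<open>Z\<close> only, because evaluation at an element \<open>t\<close> of the coefficient field
  is not injective on all polynomials.\<close>

lemma letter_action_shear:
  fixes ev :: "'c::idom poly \<Rightarrow> 'l::field" and \<beta> :: "'f::ab_group_add \<Rightarrow> 'c poly"
  assumes ev: "ring_map ev"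
    and Z: "1 \<in> Z" "\<And>p q. p \<in> Z \<Longrightarrow> q \<in> Z \<Longrightarrow> p + q \<in> Z" "\<And>p q. p \<in> Z \<Longrightarrow> q \<in> Z \<Longrightarrow> p * q \<in> Z"
    and inj: "inj_on ev Z"
    and \<beta>: "\<And>f g. \<beta> (f + g) = \<beta> f + \<beta> g" "\<And>f. \<beta> f \<in> Z" "\<And>f. f \<noteq> 0 \<Longrightarrow> degree (\<beta> f) > 0"
  shows "letter_action (\<lambda>l M. shear (\<lambda>f. ev (\<beta> f)) l ** M) (mat 1)"
proof
  let ?\<alpha> = "\<lambda>f. ev (\<beta> f)"
  have \<beta>0: "\<beta> 0 = 0" using \<beta>(1)[of 0 0] by (metis add.right_neutral add_left_cancel)
  show "shear ?\<alpha> (b, f) ** (shear ?\<alpha> (b, g) ** M) = shear ?\<alpha> (b, f + g) ** M" for b f g M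
    unfolding matrix_mul_assoc by (subst shear_add) (simp_all add: \<beta> ring_mapD[OF ev])
  show "shear ?\<alpha> (b, 0) ** M = M" for b M
    by (subst shear_0) (simp_all add: \<beta>0 ring_mapD[OF ev])
  fix w :: "'f word" assume w: "reduced w" "w \<noteq> []"
  show "foldr (\<lambda>l M. shear ?\<alpha> l ** M) w (mat 1) \<noteq> mat 1"
  proof
    assume eq: "foldr (\<lambda>l M. shear ?\<alpha> l ** M) w (mat 1) = mat 1"
    define z where "z = foldr (lin_act \<beta>) w (1, 1)"
    have "fst z \<in> Z \<and> snd z \<in> Z"
      unfolding z_def by (induction w) (auto simp: lin_act_def Z \<beta>)
    moreover have "vector [ev (fst z), ev (snd z)] = (vector [ev 1, ev 1] :: 'l^2)"
      using foldr_shear_vector[OF ev, of \<beta> w 1 1] unfolding eq z_def by simp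
    then have "ev (fst z) = ev (snd z)"
      by (simp add: vec_eq_iff forall_2)
    ultimately have "fst z = snd z" using inj by (auto dest: inj_onD)
    then show False using degree_foldr_lin_act[of w \<beta>, OF w \<beta>(3)] unfolding z_def by simp
  qed
qed

text \<open>Triangular maps and shears are both faithful realisations of the free product of two
  copies of \<open>K[x]\<close>, and every automorphism in question is a word in the former.\<close>

theorem AutU_embeds:
  fixes ev :: "'c::idom poly \<Rightarrow> 'l::field" and \<beta> :: "'a::field poly \<Rightarrow> 'c poly"
  assumes "ring_map ev"
    and "1 \<in> Z" "\<And>p q. p \<in> Z \<Longrightarrow> q \<in> Z \<Longrightarrow> p + q \<in> Z" "\<And>p q. p \<in> Z \<Longrightarrow> q \<in> Z \<Longrightarrow> p * q \<in> Z"
    and "inj_on ev Z"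
    and "\<And>f g. \<beta> (f + g) = \<beta> f + \<beta> g" "\<And>f. \<beta> f \<in> Z" "\<And>f. f \<noteq> 0 \<Longrightarrow> degree (\<beta> f) > 0"
  shows "group_embeds (AutS_A2 (U_lin :: ('a^2^2) set)) (SL2 TYPE('l))"
proof (rule group_embedsI[OF letter_action_pair_act letter_action_shear])
  let ?\<alpha> = "\<lambda>f. ev (\<beta> f)"
  show "mult (AutS_A2 U_lin) (foldr tri_act w (poly2_x, poly2_y)) (foldr tri_act w' (poly2_x, poly2_y))
      = foldr tri_act (w @ w') (poly2_x :: 'a poly2, poly2_y)" for w w'
    by (simp add: mult_AutS poly2_comp_foldr)
  show "mult (SL2 TYPE('l)) (foldr (\<lambda>l M. shear ?\<alpha> l ** M) w (mat 1)) (foldr (\<lambda>l M. shear ?\<alpha> l ** M) w' (mat 1))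
      = foldr (\<lambda>l M. shear ?\<alpha> l ** M) (w @ w') (mat 1)" for w w'
    by (simp add: SL2_def foldr_shear_mult)
  show "foldr (\<lambda>l M. shear ?\<alpha> l ** M) w (mat 1) \<in> carrier (SL2 TYPE('l))" for w
    by (simp add: SL2_def det_foldr_shear)
  show "\<exists>w. foldr tri_act w (poly2_x, poly2_y) = \<phi>" if "\<phi> \<in> carrier AutU" for \<phi> :: "'a poly2 \<times> 'a poly2"
    using AutU_generated[OF that] .
  show "group (AutU :: ('a poly2 \<times> 'a poly2) monoid)" by (rule group_AutU_A2)
qed (fact assms)+

lemma Aut1_embeds:
  assumes "group_embeds (AutS_A2 (U_lin :: ('a::field^2^2) set)) H"
  shows "group_embeds (AutS_A2 {mat 1 :: 'a^2^2}) H"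
proof -
  have "(mat 1 :: 'a^2^2) \<in> U_lin"
    by (auto simp: U_lin_def vec_eq_iff forall_2 intro!: exI[of _ 0])
  then have sub: "carrier (AutS_A2 {mat 1 :: 'a^2^2}) \<subseteq> carrier (AutS_A2 U_lin)"
    by (auto simp: AutS_A2_def)
  obtain h where "h \<in> mon (AutS_A2 (U_lin :: ('a^2^2) set)) H"
    using assms unfolding group_embeds_def by blast
  then have "h \<in> mon (AutS_A2 {mat 1 :: 'a^2^2}) H"
    using sub unfolding mon_def hom_def mult_AutS by (auto intro: inj_on_subset)
  then show ?thesis unfolding group_embeds_def by blast
qed

lemma ring_map_Fract: "ring_map (\<lambda>p :: 'b::idom. Fract p 1)"
  by (simp add: ring_map_def One_fract_def)

lemma AutU_embeds_fract: "group_embeds (AutS_A2 (U_lin :: ('a::field^2^2) set)) (SL2 TYPE('a poly fract))"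
  by (rule AutU_embeds[where ev = "\<lambda>p. Fract p 1" and Z = UNIV and \<beta> = "pCons 0", OF ring_map_Fract])
     (auto simp: inj_on_def eq_fract)

section \<open>Additive maps from cardinalities\<close>

text \<open>A denominator that vanishes in \<open>'a\<close> gives the value 0, which belongs to the
  prime field anyway.\<close>

definition prime_field_set :: "'a::field set" where
  "prime_field_set = range (\<lambda>(m::int, n::int). of_int m / of_int n)"

lemma prime_field_setI: "of_int m / of_int n \<in> prime_field_set"
  unfolding prime_field_set_def by force

lemma prime_field_set_closed:
  assumes "x \<in> prime_field_set" "y \<in> prime_field_set"
  shows "x + y \<in> prime_field_set" "x * y \<in> prime_field_set" "- x \<in> prime_field_set"
    "inverse x \<in> prime_field_set" "x - y \<in> prime_field_set" "x / y \<in> prime_field_set"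
proof -
  have mult: "x * y \<in> prime_field_set" and inv: "inverse x \<in> prime_field_set"
    and uminus: "- x \<in> prime_field_set"
    if xy: "x \<in> prime_field_set" "y \<in> prime_field_set" for x y :: 'a
  proof -
    obtain m n m' n' where mn: "x = of_int m / of_int n" "y = of_int m' / of_int n'"
      using xy unfolding prime_field_set_def by auto
    show "x * y \<in> prime_field_set" "inverse x \<in> prime_field_set" "- x \<in> prime_field_set"
      using prime_field_setI[of "m * m'" "n * n'"] prime_field_setI[of n m] prime_field_setI[of "- m" n]
      by (simp_all add: mn)
  qed
  have add: "x + y \<in> prime_field_set" if xy: "x \<in> prime_field_set" "y \<in> prime_field_set" for x y :: 'a
  proof -
    obtain m n m' n' where mn: "x = of_int m / of_int n" "y = of_int m' / of_int n'"
      using xy unfolding prime_field_set_def by auto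
    show ?thesis
    proof (cases "of_int n = (0::'a) \<or> of_int n' = (0::'a)")
      case True
      then show ?thesis using xy by (auto simp: mn)
    next
      case False
      then show ?thesis
        using prime_field_setI[of "m * n' + m' * n" "n * n'"] by (simp add: mn field_simps)
    qed
  qed
  show "x + y \<in> prime_field_set" "x * y \<in> prime_field_set" "- x \<in> prime_field_set"
    "inverse x \<in> prime_field_set" "x - y \<in> prime_field_set" "x / y \<in> prime_field_set"
    using add[OF assms] mult[OF assms] uminus[OF assms] inv[OF assms] add[OF assms(1) uminus[OF assms(2,1)]]
      mult[OF assms(1) inv[OF assms(2,1)]]
    by (simp_all add: divide_inverse)
qed

lemma prime_field_set_0_1: "0 \<in> prime_field_set" "1 \<in> prime_field_set"
  using prime_field_setI[of 0 1] prime_field_setI[of 1 1] by simp_all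

text \<open>The prime field of \<open>'a\<close> as a type, so that \<open>'a\<close>-modules become instances of the locale
  \<open>vector_space\<close> over it.\<close>

typedef (overloaded) 'a prime_field = "prime_field_set :: 'a::field set"
  using prime_field_set_0_1 by blast

setup_lifting type_definition_prime_field

instantiation prime_field :: (field) field
begin

lift_definition zero_prime_field :: "'a prime_field" is 0 by (rule prime_field_set_0_1)
lift_definition one_prime_field :: "'a prime_field" is 1 by (rule prime_field_set_0_1)
lift_definition plus_prime_field :: "'a prime_field \<Rightarrow> 'a prime_field \<Rightarrow> 'a prime_field" is "(+)"
  by (rule prime_field_set_closed)
lift_definition minus_prime_field :: "'a prime_field \<Rightarrow> 'a prime_field \<Rightarrow> 'a prime_field" is "(-)"
  by (rule prime_field_set_closed)
lift_definition uminus_prime_field :: "'a prime_field \<Rightarrow> 'a prime_field" is uminus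
  by (rule prime_field_set_closed)
lift_definition times_prime_field :: "'a prime_field \<Rightarrow> 'a prime_field \<Rightarrow> 'a prime_field" is "(*)"
  by (rule prime_field_set_closed)
lift_definition inverse_prime_field :: "'a prime_field \<Rightarrow> 'a prime_field" is inverse
  by (rule prime_field_set_closed)
lift_definition divide_prime_field :: "'a prime_field \<Rightarrow> 'a prime_field \<Rightarrow> 'a prime_field" is "(/)"
  by (rule prime_field_set_closed)

instance
  by standard (transfer; simp add: algebra_simps divide_inverse)+

end

lemma countable_prime_field: "countable (UNIV :: 'a::field prime_field set)"
proof -
  have "countable (prime_field_set :: 'a set)" unfolding prime_field_set_def by simp
  then have "countable (Abs_prime_field ` (prime_field_set :: 'a set))" by simp
  then show ?thesis by (metis type_definition.Abs_image type_definition_prime_field)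
qed

interpretation prime_poly: vector_space "\<lambda>(c :: 'a::field prime_field) (p :: 'a poly). smult (Rep_prime_field c) p"
  by standard (simp_all add: smult_add_right smult_add_left plus_prime_field.rep_eq
      times_prime_field.rep_eq one_prime_field.rep_eq)

interpretation prime_poly_pair: vector_space_pair
  "\<lambda>(c :: 'a::field prime_field) (p :: 'a poly). smult (Rep_prime_field c) p"
  "\<lambda>(c :: 'a::field prime_field) (p :: 'a poly). smult (Rep_prime_field c) p" ..

text \<open>Elements of the span come from finite lists of pairs of a scalar and a vector, and the
  scalars are countable.\<close>

lemma card_span_le:
  fixes C :: "'a::field poly set"
  assumes "infinite C"
  shows "|prime_poly.span C| \<le>o |C|"
proof -
  let ?s = "\<lambda>xs :: ('a prime_field \<times> 'a poly) list. \<Sum>(c, v)\<leftarrow>xs. smult (Rep_prime_field c) v"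
  have "x \<in> ?s ` lists (UNIV \<times> C)" if "x \<in> prime_poly.span C" for x
    using that
  proof (induction rule: prime_poly.span_induct_alt)
    case base
    show ?case by (rule image_eqI[of _ _ "[]"]) simp_all
  next
    case (step c x y)
    then obtain xs where "y = ?s xs" "xs \<in> lists (UNIV \<times> C)" by blast
    then show ?case using step(1) by (intro image_eqI[of _ _ "(c, x) # xs"]) simp_all
  qed
  then have "|prime_poly.span C| \<le>o |?s ` lists (UNIV \<times> C)|" by (intro card_of_mono1) blast
  also have "|?s ` lists (UNIV \<times> C)| \<le>o |lists ((UNIV :: 'a prime_field set) \<times> C)|" by (rule card_of_image)
  also have "|lists ((UNIV :: 'a prime_field set) \<times> C)| =o |(UNIV :: 'a prime_field set) \<times> C|"
    using assms by (intro card_of_lists_infinite) (auto dest: finite_cartesian_productD2)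
  also have "|(UNIV :: 'a prime_field set) \<times> C| \<le>o |C|"
  proof (rule card_of_Sigma_ordLeq_infinite[OF assms])
    obtain f :: "'a prime_field \<Rightarrow> nat" where "inj f"
      using countable_prime_field by (auto simp: countable_def)
    then have "|UNIV :: 'a prime_field set| \<le>o |UNIV :: nat set|"
      using card_of_ordLeq by blast
    then show "|UNIV :: 'a prime_field set| \<le>o |C|"
      using assms infinite_iff_card_of_nat ordLeq_transitive by blast
  qed simp
  finally show ?thesis .
qed

text \<open>A basis of all polynomials has at most as many elements as a basis of \<open>W\<close>;
  an injection between the bases extends linearly over the prime field.\<close>

lemma additive_injection:
  fixes W :: "'a::field poly set"
  assumes W: "prime_poly.subspace W" and card: "|UNIV :: 'a poly set| \<le>o |W|" and mon: "\<And>n. monom 1 n \<in> W"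
  shows "\<exists>\<beta> :: 'a poly \<Rightarrow> 'a poly. (\<forall>f g. \<beta> (f + g) = \<beta> f + \<beta> g) \<and> inj \<beta> \<and> range \<beta> \<subseteq> W"
proof -
  let ?s = "\<lambda>(c :: 'a prime_field) (p :: 'a poly). smult (Rep_prime_field c) p"
  obtain B :: "'a poly set" where "B \<subseteq> UNIV"
    and B: "prime_poly.independent B" "UNIV \<subseteq> prime_poly.span B"
    by (rule prime_poly.maximal_independent_subset)
  obtain C where C: "C \<subseteq> W" "prime_poly.independent C" "W \<subseteq> prime_poly.span C"
    by (rule prime_poly.maximal_independent_subset)
  \<comment> \<open>Finitely many polynomials span only polynomials of bounded degree, but
    \<open>W\<close> contains every monomial.\<close>
  have "infinite C"
  proof
    assume "finite C"
    define N where "N = Max (insert 0 (degree ` C))"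
    have "prime_poly.subspace {p :: 'a poly. degree p \<le> N}"
      by (rule prime_poly.subspaceI) (auto intro: degree_add_le order_trans[OF degree_smult_le])
    moreover have "C \<subseteq> {p. degree p \<le> N}" using \<open>finite C\<close> unfolding N_def by auto
    ultimately have "prime_poly.span C \<subseteq> {p. degree p \<le> N}" by (rule prime_poly.span_minimal[rotated])
    then have "degree (monom (1::'a) (Suc N)) \<le> N" using mon C(3) by blast
    then show False by (simp add: degree_monom_eq)
  qed
  have "|B| \<le>o |UNIV :: 'a poly set|" by (intro card_of_mono1) simp
  also note card
  also have "|W| \<le>o |prime_poly.span C|" by (intro card_of_mono1 C)
  also have "|prime_poly.span C| \<le>o |C|" by (rule card_span_le[OF \<open>infinite C\<close>])
  finally obtain \<phi> where \<phi>: "inj_on \<phi> B" "\<phi> ` B \<subseteq> C" unfolding card_of_ordLeq[symmetric] by blast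
  define \<beta> where "\<beta> = prime_poly_pair.construct B \<phi>"
  have lin: "Vector_Spaces.linear ?s ?s \<beta>"
    unfolding \<beta>_def by (rule prime_poly_pair.linear_construct[OF B(1)])
  have \<beta>B: "\<beta> b = \<phi> b" if "b \<in> B" for b
    unfolding \<beta>_def by (rule prime_poly_pair.construct_basis[OF B(1) that])
  have ind: "prime_poly.independent (\<beta> ` B)"
    using \<phi>(2) C(2) \<beta>B prime_poly.independent_mono by (metis image_cong)
  have "inj_on \<beta> (prime_poly.span B)"
    using prime_poly_pair.linear_inj_on_span_independent_image[OF lin ind] \<phi>(1) \<beta>B
    by (simp add: inj_on_def)
  then have "inj \<beta>" using B(2) by (metis top.extremum_uniqueI)
  moreover have "\<beta> x \<in> W" for x
  proof -
    have "\<beta> x \<in> prime_poly.span (\<phi> ` B)"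
      unfolding \<beta>_def by (rule prime_poly_pair.construct_in_span[OF B(1)])
    also have "\<dots> \<subseteq> W" using \<phi>(2) C(1) by (intro prime_poly.span_minimal W) blast
    finally show ?thesis .
  qed
  ultimately show ?thesis
    using prime_poly_pair.linear_add[OF lin] by blast
qed

section \<open>Maximal subrings over which an element is transcendental\<close>

definition poly_over :: "'a::comm_ring_1 set \<Rightarrow> 'a poly set" where
  "poly_over R = {p. \<forall>i. coeff p i \<in> R}"

definition is_subring :: "'a::comm_ring_1 set \<Rightarrow> bool" where
  "is_subring R \<longleftrightarrow> 1 \<in> R \<and> (\<forall>x\<in>R. \<forall>y\<in>R. x - y \<in> R \<and> x * y \<in> R)"

definition transcendental_over :: "'a::comm_ring_1 \<Rightarrow> 'a set \<Rightarrow> bool" where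
  "transcendental_over t R \<longleftrightarrow> (\<forall>p\<in>poly_over R. poly p t = 0 \<longrightarrow> p = 0)"

lemma is_subringD:
  assumes "is_subring R"
  shows "1 \<in> R" "0 \<in> R" "x \<in> R \<Longrightarrow> y \<in> R \<Longrightarrow> x - y \<in> R" "x \<in> R \<Longrightarrow> y \<in> R \<Longrightarrow> x * y \<in> R"
    "x \<in> R \<Longrightarrow> - x \<in> R" "x \<in> R \<Longrightarrow> y \<in> R \<Longrightarrow> x + y \<in> R"
    "(\<And>i. i \<in> A \<Longrightarrow> f i \<in> R) \<Longrightarrow> sum f A \<in> R"
proof -
  show 1: "1 \<in> R" and d: "x \<in> R \<Longrightarrow> y \<in> R \<Longrightarrow> x - y \<in> R" and "x \<in> R \<Longrightarrow> y \<in> R \<Longrightarrow> x * y \<in> R" for x y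
    using assms by (auto simp: is_subring_def)
  show 0: "0 \<in> R" using d[OF 1 1] by simp
  show u: "x \<in> R \<Longrightarrow> - x \<in> R" for x using d[OF 0, of x] by simp
  show a: "x \<in> R \<Longrightarrow> y \<in> R \<Longrightarrow> x + y \<in> R" for x y using d[of x "- y"] u by simp
  show "(\<And>i. i \<in> A \<Longrightarrow> f i \<in> R) \<Longrightarrow> sum f A \<in> R"
    by (induction A rule: infinite_finite_induct) (simp_all add: 0 a)
qed

lemma is_subring_poly_over:
  assumes "is_subring R"
  shows "is_subring (poly_over R)"
proof -
  note S = is_subringD[OF assms]
  have "p * q \<in> poly_over R" if "p \<in> poly_over R" "q \<in> poly_over R" for p q
    using that unfolding poly_over_def by (auto simp: coeff_mult intro!: S(4,7))
  moreover have "p - q \<in> poly_over R" if "p \<in> poly_over R" "q \<in> poly_over R" for p q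
    using that unfolding poly_over_def by (auto intro: S(3))
  moreover have "1 \<in> poly_over R" using S(1,2) unfolding poly_over_def by (auto simp: coeff_1)
  ultimately show ?thesis unfolding is_subring_def by blast
qed

lemma const_poly_over: "is_subring R \<Longrightarrow> c \<in> R \<Longrightarrow> [:c:] \<in> poly_over R"
  using is_subringD(2)[of R] by (auto simp: poly_over_def coeff_pCons split: nat.splits)

lemma monom_poly_over: "is_subring R \<Longrightarrow> monom 1 n \<in> poly_over R"
  using is_subringD(1,2)[of R] by (auto simp: poly_over_def)

lemma is_subring_adjoin:
  assumes "is_subring R"
  shows "is_subring ((\<lambda>p. poly p u) ` poly_over R)"
  unfolding is_subring_def
proof (intro conjI ballI)
  note S = is_subringD[OF is_subring_poly_over[OF assms]]
  show "1 \<in> (\<lambda>p. poly p u) ` poly_over R" using S(1) by (intro image_eqI[of _ _ 1]) simp_all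
  fix x y assume "x \<in> (\<lambda>p. poly p u) ` poly_over R" "y \<in> (\<lambda>p. poly p u) ` poly_over R"
  then obtain p q where pq: "p \<in> poly_over R" "q \<in> poly_over R" "x = poly p u" "y = poly q u" by blast
  show "x - y \<in> (\<lambda>p. poly p u) ` poly_over R" "x * y \<in> (\<lambda>p. poly p u) ` poly_over R"
    using S(3,4)[OF pq(1,2)] pq(3,4) by (auto intro: image_eqI[of _ _ "p - q"] image_eqI[of _ _ "p * q"])
qed

text \<open>Zorn's lemma applies because a polynomial has finitely many coefficients, so one over
  the union of a chain is already over a member.\<close>

lemma exists_maximal_subring:
  fixes t :: "'a::comm_ring_1"
  assumes "is_subring R0" "transcendental_over t R0"
  shows "\<exists>R. R0 \<subseteq> R \<and> is_subring R \<and> transcendental_over t R \<and>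
    (\<forall>R'. R \<subseteq> R' \<longrightarrow> is_subring R' \<longrightarrow> transcendental_over t R' \<longrightarrow> R' = R)"
proof -
  define \<A> where "\<A> = {R. R0 \<subseteq> R \<and> is_subring R \<and> transcendental_over t R}"
  have "\<exists>M\<in>\<A>. \<forall>X\<in>\<A>. M \<subseteq> X \<longrightarrow> X = M"
  proof (rule subset_Zorn_nonempty)
    show "\<A> \<noteq> {}" using assms by (auto simp: \<A>_def)
    fix \<C> assume ne: "\<C> \<noteq> {}" and chain: "subset.chain \<A> \<C>"
    have C: "\<And>R. R \<in> \<C> \<Longrightarrow> R0 \<subseteq> R \<and> is_subring R \<and> transcendental_over t R"
      and tot: "\<And>X Y. X \<in> \<C> \<Longrightarrow> Y \<in> \<C> \<Longrightarrow> X \<subseteq> Y \<or> Y \<subseteq> X"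
      using chain unfolding \<A>_def subset_chain_def by auto
    have "is_subring (\<Union>\<C>)"
      unfolding is_subring_def
    proof (intro conjI ballI)
      show "1 \<in> \<Union>\<C>" using ne C is_subringD(1) by blast
      fix x y assume "x \<in> \<Union>\<C>" "y \<in> \<Union>\<C>"
      then obtain R where "R \<in> \<C>" "x \<in> R" "y \<in> R" using tot by blast
      then show "x - y \<in> \<Union>\<C>" "x * y \<in> \<Union>\<C>" using C is_subringD(3,4) by blast+
    qed
    moreover have "transcendental_over t (\<Union>\<C>)"
      unfolding transcendental_over_def
    proof (intro ballI impI)
      fix p assume p: "p \<in> poly_over (\<Union>\<C>)" "poly p t = 0"
      have "finite (coeff p ` {..degree p})" "coeff p ` {..degree p} \<subseteq> \<Union>\<C>"
        using p by (auto simp: poly_over_def)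
      then obtain R where R: "R \<in> \<C>" "coeff p ` {..degree p} \<subseteq> R"
        using finite_subset_Union_chain[OF _ _ ne chain] by metis
      then have "coeff p i \<in> R" for i
        using is_subringD(2) C by (cases "i \<le> degree p") (auto simp: coeff_eq_0)
      then show "p = 0" using C[OF R(1)] p(2) unfolding transcendental_over_def poly_over_def by blast
    qed
    moreover have "R0 \<subseteq> \<Union>\<C>" using ne C by blast
    ultimately show "\<Union>\<C> \<in> \<A>" by (simp add: \<A>_def)
  qed
  then obtain M where "M \<in> \<A>" "\<And>X. X \<in> \<A> \<Longrightarrow> M \<subseteq> X \<Longrightarrow> X = M" by metis
  moreover have "R' = M" if "M \<subseteq> R'" "is_subring R'" "transcendental_over t R'" for R'
    using calculation that unfolding \<A>_def by (metis (mono_tags, lifting) mem_Collect_eq subset_trans)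
  ultimately show ?thesis unfolding \<A>_def by (intro exI[of _ M]) simp
qed

text \<open>For \<open>u\<close> outside \<open>R\<close>, maximality makes \<open>t\<close>
  algebraic over \<open>R[u]\<close>; the relation is read as an equation for \<open>u\<close> over
  \<open>R[t]\<close>.\<close>

lemma algebraic_over_maximal_subring:
  fixes t u :: "'a::field"
  assumes R: "is_subring R" and t: "transcendental_over t R"
    and max: "\<And>R'. R \<subseteq> R' \<Longrightarrow> is_subring R' \<Longrightarrow> transcendental_over t R' \<Longrightarrow> R' = R"
  shows "\<exists>q\<in>poly_over (poly_over R). map_poly (\<lambda>c. poly c t) q \<noteq> 0 \<and> poly (map_poly (\<lambda>c. poly c t) q) u = 0"
proof (cases "u \<in> R")
  case True
  let ?q = "monom 1 1 - [:[:u:]:] :: 'a poly poly"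
  have RR: "is_subring (poly_over R)" by (rule is_subring_poly_over[OF R])
  have "?q \<in> poly_over (poly_over R)"
    using is_subringD(3)[OF is_subring_poly_over[OF RR]] monom_poly_over[OF RR]
      const_poly_over[OF RR const_poly_over[OF R True]] by blast
  moreover have "map_poly (\<lambda>c. poly c t) ?q = [:- u, 1:]"
    by (intro poly_eqI) (auto simp: coeff_map_poly coeff_pCons split: nat.splits)
  ultimately show ?thesis by (intro bexI[of _ ?q]) simp_all
next
  case False
  let ?R' = "(\<lambda>p. poly p u) ` poly_over R"
  note S = is_subringD[OF R]
  have sub: "R \<subseteq> ?R'"
  proof
    fix x assume "x \<in> R"
    then show "x \<in> ?R'" by (intro image_eqI[of _ _ "[:x:]"] const_poly_over[OF R]) simp_all
  qed
  have "u \<in> ?R'"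
    using monom_poly_over[OF R, of 1] by (intro image_eqI[of _ _ "monom 1 1"]) (simp_all add: poly_monom)
  then have "\<not> transcendental_over t ?R'" using max[OF sub is_subring_adjoin[OF R]] False by blast
  then obtain p where p: "p \<in> poly_over ?R'" "poly p t = 0" "p \<noteq> 0"
    unfolding transcendental_over_def by blast
  obtain c where c: "\<And>i. c i \<in> poly_over R" "\<And>i. coeff p i = poly (c i) u"
  proof -
    have "\<exists>c. c \<in> poly_over R \<and> coeff p i = poly c u" for i using p(1) unfolding poly_over_def[of ?R'] by blast
    then show thesis using that by metis
  qed
  \<comment> \<open>The relation with its variables exchanged: \<open>t\<close> belongs to the inner
    one and \<open>u\<close> to the outer one. It stays nonzero at \<open>t\<close> by transcendence
    over \<open>R\<close>.\<close>
  define q where "q = (\<Sum>i\<le>degree p. map_poly (\<lambda>a. monom a i) (c i))"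
  have cq: "coeff (coeff q j) k = (if k \<le> degree p then coeff (c k) j else 0)" for j k
    unfolding q_def by (simp add: coeff_sum coeff_map_poly)
  have "q \<in> poly_over (poly_over R)"
    using c(1) S(2) unfolding poly_over_def by (simp add: cq)
  moreover have "map_poly (\<lambda>c. poly c t) q \<noteq> 0"
  proof
    assume 0: "map_poly (\<lambda>c. poly c t) q = 0"
    have "coeff q j = 0" for j
    proof -
      have "poly (coeff q j) t = 0" using arg_cong[OF 0, of "\<lambda>p. coeff p j"] by (simp add: coeff_map_poly)
      moreover have "coeff q j \<in> poly_over R" using \<open>q \<in> _\<close> by (simp add: poly_over_def)
      ultimately show ?thesis using t unfolding transcendental_over_def by blast
    qed
    then have "coeff (c (degree p)) j = 0" for j using cq[of j "degree p"] by simp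
    then have "c (degree p) = 0" by (intro poly_eqI) simp
    then show False using c(2)[of "degree p"] p(3) by simp
  qed
  moreover have "poly (map_poly (\<lambda>c. poly c t) q) u = 0"
  proof -
    have "poly (map_poly (\<lambda>c. poly c t) q) u
        = (\<Sum>i\<le>degree p. poly (map_poly (\<lambda>c. poly c t) (map_poly (\<lambda>a. monom a i) (c i))) u)"
      unfolding q_def by (rule ring_map_sum[OF ring_map_eval_map_poly[OF ring_map_poly]])
    also have "\<dots> = (\<Sum>i\<le>degree p. poly (c i) u * t ^ i)"
    proof (rule sum.cong)
      fix i
      have "map_poly (\<lambda>c. poly c t) (map_poly (\<lambda>a. monom a i) (c i)) = smult (t ^ i) (c i)"
        by (rule poly_eqI) (simp add: coeff_map_poly poly_monom)
      then show "poly (map_poly (\<lambda>c. poly c t) (map_poly (\<lambda>a. monom a i) (c i))) u = poly (c i) u * t ^ i"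
        by simp
    qed simp
    also have "\<dots> = poly p t" by (simp add: poly_altdef c(2))
    finally show ?thesis using p(2) by simp
  qed
  ultimately show ?thesis by blast
qed

lemma inj_on_transcendental:
  assumes "is_subring R" "transcendental_over t R"
  shows "inj_on (\<lambda>p. poly p t) (poly_over R)"
proof (rule inj_onI)
  fix p q assume pq: "p \<in> poly_over R" "q \<in> poly_over R" "poly p t = poly q t"
  then have "p - q \<in> poly_over R" using is_subringD(3)[OF is_subring_poly_over[OF assms(1)]] by blast
  then show "p = q" using assms(2) pq(3) unfolding transcendental_over_def by auto
qed

lemma infinite_poly_over:
  assumes "is_subring R"
  shows "infinite (poly_over R)"
proof
  assume "finite (poly_over R)"
  then have "finite (range (monom (1::'a)))"
    by (rule finite_subset[rotated]) (use monom_poly_over[OF assms] in blast)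
  moreover have "inj (monom (1::'a))" by (auto intro: injI simp: monom_eq_iff')
  ultimately show False using finite_imageD by blast
qed

lemma card_poly_over_le:
  fixes S :: "'b::comm_ring_1 set"
  assumes "infinite S"
  shows "|poly_over S| \<le>o |S|"
proof -
  have "coeffs ` poly_over S \<subseteq> lists S"
    unfolding poly_over_def coeffs_def by auto
  moreover have "inj_on coeffs (poly_over S)" by (auto intro: inj_onI simp: coeffs_eq_iff)
  ultimately have "|poly_over S| \<le>o |lists S|" using card_of_ordLeq by blast
  also have "|lists S| =o |S|" by (rule card_of_lists_infinite[OF assms])
  finally show ?thesis .
qed

text \<open>The field is a union of finite root sets, indexed by polynomials over the infinite ring
  \<open>R[t]\<close>, so it is no larger than that ring.\<close>

lemma card_poly_le_maximal_subring:
  fixes t :: "'a::field"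
  assumes R: "is_subring R" and t: "transcendental_over t R"
    and max: "\<And>R'. R \<subseteq> R' \<Longrightarrow> is_subring R' \<Longrightarrow> transcendental_over t R' \<Longrightarrow> R' = R"
  shows "|UNIV :: 'a poly set| \<le>o |poly_over R|"
proof -
  let ?Z = "poly_over R" and ?m = "map_poly (\<lambda>c. poly c t)"
  have inf: "infinite ?Z" by (rule infinite_poly_over[OF R])
  have "infinite (UNIV :: 'a set)"
    using inf inj_on_transcendental[OF R t] finite_imageD finite_subset subset_UNIV by metis
  then have "|UNIV :: 'a poly set| \<le>o |UNIV :: 'a set|"
    using card_poly_over_le[of "UNIV :: 'a set"] by (simp add: poly_over_def)
  also have "|UNIV :: 'a set| \<le>o |\<Union>q\<in>poly_over ?Z. if ?m q = 0 then {} else {u. poly (?m q) u = 0}|"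
    using algebraic_over_maximal_subring[OF R t max] by (intro card_of_mono1) fastforce
  also have "|\<Union>q\<in>poly_over ?Z. if ?m q = 0 then {} else {u. poly (?m q) u = 0}| \<le>o |?Z|"
  proof (rule card_of_UNION_ordLeq_infinite[OF inf card_poly_over_le[OF inf]], rule ballI)
    fix q
    have "finite (if ?m q = 0 then {} else {u. poly (?m q) u = 0})"
      by (auto intro: poly_roots_finite)
    then show "|if ?m q = 0 then {} else {u. poly (?m q) u = 0}| \<le>o |?Z|"
      using inf by (meson finite_ordLess_infinite2 ordLess_imp_ordLeq)
  qed
  finally show ?thesis .
qed

section \<open>The embeddings\<close>

theorem AutU_embeds_of_rational_function_subfield:
  fixes h :: "'k::field poly fract \<Rightarrow> 'a::field"
  assumes "field_embedding h"
  shows "group_embeds (AutS_A2 (U_lin :: ('a^2^2) set)) (SL2 TYPE('a))"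
proof -
  define \<iota> where "\<iota> = (\<lambda>p :: 'k poly. h (Fract p 1))"
  define k where "k = (\<lambda>c. \<iota> [:c:])"
  define t where "t = \<iota> [:0, 1:]"
  have h: "ring_map h" "inj h" using assms unfolding field_embedding_def ring_map_def by auto
  have \<iota>: "ring_map \<iota>" unfolding \<iota>_def by (rule ring_map_comp[OF h(1) ring_map_Fract])
  have \<iota>_inj: "\<iota> p = 0 \<Longrightarrow> p = 0" for p
    using inj_onD[OF h(2), of "Fract p 1" 0] ring_mapD(4)[OF h(1)]
    unfolding \<iota>_def by (simp add: Zero_fract_def eq_fract)
  have k: "ring_map k" unfolding k_def by (rule ring_map_comp[OF \<iota> ring_map_const])
  have \<iota>_eval: "poly (map_poly k p) t = \<iota> p" for p
    using poly_map_poly_ring_map[OF ring_map_const \<iota>, of p "[:0, 1:]"]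
    by (simp add: k_def t_def flip: pcompose_altdef)
  have "is_subring (range k)"
    unfolding is_subring_def using ring_mapD[OF k] by (auto simp: image_iff) metis+
  moreover have "transcendental_over t (range k)"
    unfolding transcendental_over_def
  proof (intro ballI impI)
    fix p assume p: "p \<in> poly_over (range k)" "poly p t = 0"
    define g where "g = inv_into UNIV k"
    have kg: "k (g (coeff p i)) = coeff p i" for i
      using p(1) unfolding poly_over_def g_def by (auto intro: f_inv_into_f)
    have k0: "k c = 0 \<longleftrightarrow> c = 0" for c
      using \<iota>_inj[of "[:c:]"] ring_mapD(4)[OF k] unfolding k_def by auto
    then have g0: "g 0 = 0" using ring_mapD(4)[OF k] unfolding g_def
      by (metis f_inv_into_f rangeI)
    have "p = map_poly k (map_poly g p)"
      by (rule poly_eqI) (simp add: coeff_map_poly g0 ring_mapD(4)[OF k] kg)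
    then have "\<iota> (map_poly g p) = 0" using p(2) \<iota>_eval by metis
    then have "map_poly g p = 0" by (rule \<iota>_inj)
    then show "p = 0" using \<open>p = map_poly k (map_poly g p)\<close> by simp
  qed
  ultimately obtain R where sub: "range k \<subseteq> R" and R: "is_subring R" and t: "transcendental_over t R"
    and max: "\<And>R'. R \<subseteq> R' \<Longrightarrow> is_subring R' \<Longrightarrow> transcendental_over t R' \<Longrightarrow> R' = R"
    using exists_maximal_subring[of "range k" t] by metis
  note S = is_subringD[OF R] and RX = is_subringD[OF is_subring_poly_over[OF R]]
  \<comment> \<open>The image of \<open>k\<close> is a field inside \<open>R\<close>, so it contains
    the prime field; this makes \<open>poly_over R\<close> a subspace.\<close>
  have "prime_field_set \<subseteq> R"
  proof
    fix x :: 'a assume "x \<in> prime_field_set"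
    then obtain m n where x: "x = of_int m / of_int n" unfolding prime_field_set_def by auto
    have nat: "k (of_nat i) = of_nat i" for i by (induction i) (simp_all add: ring_mapD[OF k])
    have int: "k (of_int i) = of_int i" for i
      by (cases i rule: int_diff_cases) (simp add: nat ring_mapD[OF k])
    have inv: "k (inverse c) = inverse (k c)" for c
    proof (cases "c = 0")
      case False
      then have "k c * k (inverse c) = 1" using ring_mapD(1,3)[OF k] by (metis right_inverse)
      then show ?thesis by (metis inverse_unique)
    qed (simp add: ring_mapD[OF k])
    have "x = k (of_int m * inverse (of_int n))"
      unfolding x ring_mapD(3)[OF k] inv int by (simp add: divide_inverse)
    then show "x \<in> R" using sub by blast
  qed
  then have "smult (Rep_prime_field c) p \<in> poly_over R" if "p \<in> poly_over R" for c p
    using that S(4) Rep_prime_field[of c] unfolding poly_over_def by auto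
  then have W: "prime_poly.subspace (poly_over R)"
    by (intro prime_poly.subspaceI RX) auto
  obtain \<beta> :: "'a poly \<Rightarrow> 'a poly" where \<beta>: "\<And>f g. \<beta> (f + g) = \<beta> f + \<beta> g" "inj \<beta>" "range \<beta> \<subseteq> poly_over R"
    using additive_injection[OF W card_poly_le_maximal_subring[OF R t max] monom_poly_over[OF R]] by blast
  have \<beta>0: "\<beta> f = 0 \<longleftrightarrow> f = 0" for f
    using \<beta>(1)[of 0 0] inj_eq[OF \<beta>(2), of f 0] by (metis add.right_neutral add_left_cancel)
  show ?thesis
  \<comment> \<open>The shift \<open>pCons 0\<close> turns the injective additive
    \<open>\<beta>\<close> into one whose nonzero values have positive degree.\<close>
  proof (rule AutU_embeds[where ev = "\<lambda>p. poly p t" and Z = "poly_over R" and \<beta> = "\<lambda>f. pCons 0 (\<beta> f)"])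
    show "pCons 0 (\<beta> f) \<in> poly_over R" for f
      using \<beta>(3) S(2) by (auto simp: poly_over_def coeff_pCons split: nat.splits)
  qed (simp_all add: ring_map_poly RX inj_on_transcendental[OF R t] \<beta>(1) \<beta>0)
qed

theorem theoremA2:
  shows "group_embeds (AutS_A2 {mat 1 :: 'a::field^2^2}) (SL2 TYPE('a poly fract))
       \<and> group_embeds (AutS_A2 (U_lin :: ('a^2^2) set)) (SL2 TYPE('a poly fract))
       \<and> (infinite (UNIV :: 'k::field set) \<and> (\<exists>h :: 'k poly fract \<Rightarrow> 'a. field_embedding h) \<longrightarrow>
            group_embeds (AutS_A2 (U_lin :: ('a^2^2) set)) (SL2 TYPE('a))
          \<and> group_embeds (AutS_A2 {mat 1 :: 'a^2^2}) (SL2 TYPE('a)))"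
proof (intro conjI impI)
  show "group_embeds (AutS_A2 {mat 1 :: 'a^2^2}) (SL2 TYPE('a poly fract))"
    by (rule Aut1_embeds[OF AutU_embeds_fract])
  show "group_embeds (AutS_A2 (U_lin :: ('a^2^2) set)) (SL2 TYPE('a poly fract))"
    by (rule AutU_embeds_fract)
  assume "infinite (UNIV :: 'k set) \<and> (\<exists>h :: 'k poly fract \<Rightarrow> 'a. field_embedding h)"
  then show U: "group_embeds (AutS_A2 (U_lin :: ('a^2^2) set)) (SL2 TYPE('a))"
    using AutU_embeds_of_rational_function_subfield by (elim conjE exE)
  then show "group_embeds (AutS_A2 {mat 1 :: 'a^2^2}) (SL2 TYPE('a))"
    by (rule Aut1_embeds)
qed

end
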